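(* Let $n\ge 1$. The dual of the type $B$ permutohedron $\operatorname{Perm}(B_n)$ is a simplicial polytope whose boundary complex is combinatorially equivalent to a Tchebyshev triangulation of the suspension of the order complex $\triangle(P([1,n])-\{\emptyset,[1,n]\})$.
   Context: $[1,n]=\{1,2,\ldots,n\}$. The type $B$ permutohedron $\operatorname{Perm}(B_n)$ is the convex hull in $\mathbb{R}^n$ of all points $(\pm\pi(1),\ldots,\pm\pi(n))$, where $\pi$ ranges over all permutations of $[1,n]$ and all choices of signs are allowed. The dual of a polytope is any polytope whose face lattice is the order dual of the face lattice of the given polytope. $P([1,n])$ is the set of all subsets of $[1,n]$ ordered by inclusion. The order complex $\triangle(Q)$ of a finite poset $Q$ is the simplicial complex on the vertex set $Q$ whose faces are the chains of $Q$, including the empty chain. The suspension of a simplicial complex is its join with the complex consisting of the empty face and two isolated vertices (the boundary complex of a one-dimensional simplex); the join of complexes $\triangle_1,\triangle_2$ on disjoint vertex sets is $\{\sigma\cup\tau:\sigma\in\triangle_1,\tau\in\triangle_2\}$. The link of a face $\sigma$ in a simplicial complex $\triangle$ is $\operatorname{link}_{\triangle}(\sigma)=\{\tau\in\triangle:\ \sigma\cap\tau=\emptyset,\ \sigma\cup\tau\in\triangle\}$. Tchebyshev triangulation of a finite simplicial complex $\triangle$: number the edges $e_1,\ldots,e_m$ of $\triangle$ in some order, and associate to each edge $e_i=\{u_i,v_i\}$ a new vertex $w_i$, its midpoint. Set $\triangle_0=\triangle$. For $i\ge 1$, $\triangle_i$ is obtained from $\triangle_{i-1}$ by the stellar subdivision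 of the edge $e_i$ at $w_i$: remove all faces containing $e_i$, and for each $\tau\in\operatorname{link}_{\triangle_{i-1}}(e_i)$ add all sets $\sigma'\cup\tau$, where $\sigma'$ is a face of the path $L_i$ with vertex set $\{u_i,v_i,w_i\}$ and edge set $\{\{u_i,w_i\},\{w_i,v_i\}\}$. The complex $\triangle_m$ is a Tchebyshev triangulation of $\triangle$ (different numberings may give different Tchebyshev triangulations). *)

theory Defs
  imports "HOL-Analysis.Analysis"
begin

section \<open>Polytopes\<close>

text \<open>The coordinates of $\mathbb{R}^n$ are indexed by a type \<open>'n\<close> with $n$ elements, so a permutation
  of $[1,n]$ becomes a bijection from \<open>'n\<close> onto $[1,n]$; the resulting set of points does not depend
  on how the coordinates are numbered.\<close>

definition perm_B :: "(real ^ 'n) set" where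
  "perm_B = convex hull {x. \<exists>(p :: 'n \<Rightarrow> nat) (s :: 'n \<Rightarrow> real).
     bij_betw p UNIV {1..CARD('n)} \<and> (\<forall>i. s i \<in> {1, -1}) \<and> x = (\<chi> i. s i * real (p i))}"

text \<open>The face lattice contains the empty face and the polytope itself; both are faces in the sense
  of \<^const>\<open>face_of\<close>.\<close>

definition dual_polytope ::
    "'a::euclidean_space set \<Rightarrow> 'b::euclidean_space set \<Rightarrow> bool" where
  "dual_polytope P Q \<longleftrightarrow> polytope P \<and> polytope Q \<and>
     (\<exists>\<phi>. bij_betw \<phi> {F. F face_of P} {G. G face_of Q} \<and>
          (\<forall>F F'. F face_of P \<longrightarrow> F' face_of P \<longrightarrow> (F \<subseteq> F' \<longleftrightarrow> \<phi> F' \<subseteq> \<phi> F)))"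

definition simplicial_polytope :: "'a::euclidean_space set \<Rightarrow> bool" where
  "simplicial_polytope Q \<longleftrightarrow>
     polytope Q \<and> (\<forall>F. F face_of Q \<and> F \<noteq> Q \<longrightarrow> (\<exists>k. k simplex F))"


section \<open>Abstract simplicial complexes\<close>

text \<open>A simplicial complex is represented by the set of its faces, which includes the empty face.\<close>

text \<open>Each proper face of a simplicial polytope is represented by its set of vertices.\<close>

definition boundary_complex :: "'a::euclidean_space set \<Rightarrow> 'a set set" where
  "boundary_complex Q = {{v. v extreme_point_of F} | F. F face_of Q \<and> F \<noteq> Q}"

definition complex_iso :: "'v set set \<Rightarrow> 'w set set \<Rightarrow> bool" where
  "complex_iso K L \<longleftrightarrow> (\<exists>f. bij_betw f (\<Union>K) (\<Union>L) \<and> (\<lambda>\<sigma>. f ` \<sigma>) ` K = L)"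

definition order_complex :: "'a::order set \<Rightarrow> 'a set set" where
  "order_complex A = {C. C \<subseteq> A \<and> finite C \<and> Complete_Partial_Order.chain (\<le>) C}"

text \<open>The sum type makes the two vertex sets disjoint; \<open>\<sigma> <+> \<tau>\<close> is the union of the two copies.\<close>

definition complex_join :: "'v set set \<Rightarrow> 'w set set \<Rightarrow> ('v + 'w) set set" where
  "complex_join K L = {\<sigma> <+> \<tau> | \<sigma> \<tau>. \<sigma> \<in> K \<and> \<tau> \<in> L}"

definition suspension :: "'v set set \<Rightarrow> ('v + bool) set set" where
  "suspension K = complex_join K {{}, {False}, {True}}"

definition link :: "'v set set \<Rightarrow> 'v set \<Rightarrow> 'v set set" where
  "link K \<sigma> = {\<tau> \<in> K. \<sigma> \<inter> \<tau> = {} \<and> \<sigma> \<union> \<tau> \<in> K}"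

definition edges :: "'v set set \<Rightarrow> 'v set set" where
  "edges K = {e \<in> K. card e = 2}"

text \<open>For \<open>e = {u, v}\<close> these are the faces of the path with edges \<open>{u, w}\<close> and \<open>{w, v}\<close>.\<close>

definition path_faces :: "'v set \<Rightarrow> 'v \<Rightarrow> 'v set set" where
  "path_faces e w = {\<sigma>. \<exists>x\<in>e. \<sigma> \<subseteq> {x, w}}"

definition stellar_subdivision :: "'v set set \<Rightarrow> 'v set \<Rightarrow> 'v \<Rightarrow> 'v set set" where
  "stellar_subdivision K e w =
     {\<sigma> \<in> K. \<not> e \<subseteq> \<sigma>} \<union> {\<sigma> \<union> \<tau> | \<sigma> \<tau>. \<sigma> \<in> path_faces e w \<and> \<tau> \<in> link K e}"

text \<open>\<open>Inl v\<close> is the original vertex \<open>v\<close>, and \<open>Inr e\<close> is the midpoint of the edge \<open>e\<close>. The list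
  \<open>es\<close> is the numbering of the edges, in the order in which they are subdivided.\<close>

definition subdivide_edges :: "'v set set \<Rightarrow> 'v set list \<Rightarrow> ('v + 'v set) set set" where
  "subdivide_edges K es =
     foldl (\<lambda>L e. stellar_subdivision L (Inl ` e) (Inr e)) ((\<lambda>\<sigma>. Inl ` \<sigma>) ` K) es"

definition tchebyshev_triangulation :: "'v set set \<Rightarrow> ('v + 'v set) set set \<Rightarrow> bool" where
  "tchebyshev_triangulation K T \<longleftrightarrow>
     (\<exists>es. distinct es \<and> set es = edges K \<and> T = subdivide_edges K es)"

end

theory Submission
  imports Defs
begin

text \<open>
  A nonempty face of $\mathrm{Perm}(B_n)$ is the set of maximizers of a linear functional $c$. Writing
  $c$ as a positive combination of a chain of nonzero sign vectors in $\{-1,0,1\}^n$, ordered by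
  $u \le v$ iff $u_i \in \{0, v_i\}$ for all $i$, identifies the nonempty faces, ordered by reverse
  inclusion, with the chains of nonzero sign vectors. So in a dual polytope every proper face has a Boolean
  face lattice, is a simplex by Radon's theorem, and the boundary complex is the complex of chains
  of nonzero sign vectors.

  A nonzero sign vector $v$ is an interval $[\{i : v_i = 1\}, \{i : v_i \ne -1\}] \ne [\emptyset, [1,n]]$ of
  $P([1,n])$, and the order on sign vectors is reverse inclusion of intervals. The suspension adds
  $\emptyset$ and $[1,n]$ to the order complex as two vertices that are not joined by an edge, so
  the vertices of a Tchebyshev triangulation are exactly these intervals: a vertex is a
  one-element interval, and the midpoint of an edge is the interval spanned by it. If larger
  intervals are subdivided before smaller ones, then the faces of the triangulation are exactly
  the chains of intervals.
\<close>

section \<open>Polar duality\<close>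

text \<open>The claim about every dual would be vacuous without one, so a dual is produced as a
  polar; boundedness of the polar says that the origin is interior to the permutohedron. Chains
  appear among the faces for the following reason. A vertex is a sum of sign vectors, its layers,
  and a sign vector attains its maximum over the polytope at that vertex exactly if it is one of
  these layers. The layers of one vertex are pairwise comparable, so inequalities that are tight
  together form a chain. That different chains give different faces rests on the fact that a gap in
  a chain can always be filled in more than one way. For the triangulation, the obstacle is that a
  partial subdivision depends on the order of the edges. With larger intervals first, the
  intermediate complexes depend only on the set of edges already subdivided: when an edge is
  reached, the original vertices in its link lie inside its interval, and the midpoints in its link
  belong to intervals containing it.\<close>

definition polar :: "'a::euclidean_space set \<Rightarrow> 'a set" where
  "polar P = {y. \<forall>x\<in>P. x \<bullet> y \<le> 1}"

lemma zero_in_polar: "0 \<in> polar P"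
  by (simp add: polar_def)

lemma polar_polar:
  fixes P :: "'a::euclidean_space set"
  assumes "closed P" "convex P" "0 \<in> P"
  shows "polar (polar P) = P"
proof
  show "P \<subseteq> polar (polar P)"
    by (auto simp: polar_def inner_commute)
  show "polar (polar P) \<subseteq> P"
  proof
    fix z assume z: "z \<in> polar (polar P)"
    show "z \<in> P"
    proof (rule ccontr)
      assume "z \<notin> P"
      then obtain a b where ab: "a \<bullet> z < b" "\<forall>x\<in>P. b < a \<bullet> x"
        using separating_hyperplane_closed_point[OF assms(2,1)] by blast
      have "b < 0" using ab(2) assms(3) by force
      \<comment> \<open>Since \<open>0 \<in> P\<close>, the number \<open>b\<close> is negative;
        dividing by it turns the separation into values below 1 on \<open>P\<close> and above 1 at
        \<open>z\<close>.\<close>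
      have "(1 / b) *\<^sub>R a \<in> polar P"
        unfolding polar_def using ab(2) \<open>b < 0\<close>
        by (auto simp: inner_commute[of _ a] field_simps intro: less_imp_le)
      then have "(1 / b) *\<^sub>R a \<bullet> z \<le> 1"
        using z unfolding polar_def by blast
      then show False
        using ab(1) \<open>b < 0\<close> by (auto simp: field_simps)
    qed
  qed
qed

text \<open>Only the inequalities from a finite generating set of \<open>P\<close> matter, so the
  polar is a polyhedron, and bounded polyhedra are polytopes.\<close>

lemma polytope_polar:
  assumes "polytope P" "bounded (polar P)"
  shows "polytope (polar P)"
proof -
  obtain V where V: "finite V" "P = convex hull V"
    using assms(1) unfolding polytope_def by blast
  have "polar P = (\<Inter>v\<in>V. {y. v \<bullet> y \<le> 1})"
  proof
    show "polar P \<subseteq> (\<Inter>v\<in>V. {y. v \<bullet> y \<le> 1})"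
      using V(2) hull_inc[of _ V convex] unfolding polar_def by blast
    show "(\<Inter>v\<in>V. {y. v \<bullet> y \<le> 1}) \<subseteq> polar P"
    proof
      fix y assume "y \<in> (\<Inter>v\<in>V. {y. v \<bullet> y \<le> 1})"
      then have "V \<subseteq> {x. y \<bullet> x \<le> 1}" by (auto simp: inner_commute)
      then have "convex hull V \<subseteq> {x. y \<bullet> x \<le> 1}"
        by (rule hull_minimal) (rule convex_halfspace_le)
      then show "y \<in> polar P"
        unfolding polar_def V(2) by (auto simp: inner_commute)
    qed
  qed
  moreover have "polyhedron (\<Inter>v\<in>V. {y. v \<bullet> y \<le> 1})"
    by (rule polyhedron_Inter) (use V(1) polyhedron_halfspace_le in auto)
  ultimately show ?thesis
    using assms(2) polytope_eq_bounded_polyhedron by metis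
qed

text \<open>For \<open>F = {}\<close> the condition is vacuous and the whole polar results; for
  \<open>F = P\<close> with \<open>0 \<in> P\<close> no point satisfies it. So the improper faces
  are exchanged as well.\<close>

definition dual_face :: "'a::euclidean_space set \<Rightarrow> 'a set \<Rightarrow> 'a set" where
  "dual_face P F = {y \<in> polar P. \<forall>x\<in>F. x \<bullet> y = 1}"

lemma dual_face_face_of:
  assumes "convex (polar P)" "F \<subseteq> P"
  shows "dual_face P F face_of polar P"
proof (cases "F = {}")
  case True
  then show ?thesis
    using assms(1) by (simp add: dual_face_def face_of_refl)
next
  case False
  have "dual_face P F = (\<Inter>x\<in>F. polar P \<inter> {y. x \<bullet> y = 1})"
    using False unfolding dual_face_def by auto
  moreover have "polar P \<inter> {y. x \<bullet> y = 1} face_of polar P" if "x \<in> F" for x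
    by (rule face_of_Int_supporting_hyperplane_le)
      (use that assms in \<open>auto simp: polar_def\<close>)
  ultimately show ?thesis
    using False face_of_Inter[of "(\<lambda>x. polar P \<inter> {y. x \<bullet> y = 1}) ` F" "polar P"] by auto
qed

lemma dual_face_antimono: "F \<subseteq> F' \<Longrightarrow> dual_face P F' \<subseteq> dual_face P F"
  unfolding dual_face_def by blast

text \<open>The face is cut out by \<open>a \<bullet> x = b\<close> with
  \<open>a \<bullet> x \<le> b\<close> on \<open>P\<close>, and \<open>b \<ge> 0\<close> because
  \<open>0 \<in> P\<close>. If \<open>b > 0\<close>, the point \<open>a / b\<close> of the dual face
  already forces \<open>F\<close> back. If \<open>b = 0\<close>, all positive multiples of
  \<open>a\<close> lie in the polar, so boundedness leaves only \<open>a = 0\<close>, that is,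
  \<open>F = P\<close>.\<close>

lemma dual_face_dual_face:
  assumes P: "polytope P" "0 \<in> P" and bnd: "bounded (polar P)" and F: "F face_of P"
  shows "dual_face (polar P) (dual_face P F) = F"
proof -
  have bipolar: "polar (polar P) = P"
    by (intro polar_polar polytope_imp_closed polytope_imp_convex P)
  have FP: "F \<subseteq> P" using F face_of_imp_subset by blast
  have "F exposed_face_of P"
    using F P(1) exposed_face_of_polyhedron polytope_imp_polyhedron by blast
  then obtain a b where ab: "P \<subseteq> {x. a \<bullet> x \<le> b}" "F = P \<inter> {x. a \<bullet> x = b}"
    unfolding exposed_face_of_def by blast
  have "b \<ge> 0" using ab(1) P(2) by auto
  have "dual_face (polar P) (dual_face P F) \<subseteq> F"
  proof (cases "b = 0")
    case True
    obtain R where R: "R > 0" "\<And>y. y \<in> polar P \<Longrightarrow> norm y \<le> R"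
      using bnd bounded_pos by blast
    have "a = 0"
    proof (rule ccontr)
      assume "a \<noteq> 0"
      \<comment> \<open>The factor makes the norm of the scaled vector \<open>2 * R\<close>, beyond
        the bound \<open>R\<close> for the polar.\<close>
      define c where "c = 2 * R / norm a"
      have "c > 0" using R(1) \<open>a \<noteq> 0\<close> by (simp add: c_def)
      have "x \<bullet> (c *\<^sub>R a) \<le> 0" if "x \<in> P" for x
        using ab(1) True that \<open>c > 0\<close>
        by (auto simp: inner_commute[of x] mult_le_0_iff)
      then have "c *\<^sub>R a \<in> polar P"
        unfolding polar_def by force
      then have "norm (c *\<^sub>R a) \<le> R" by (rule R(2))
      then show False
        using R(1) \<open>a \<noteq> 0\<close> by (simp add: c_def)
    qed
    then have "F = P" using ab True by auto
    then show ?thesis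
      by (auto simp: dual_face_def bipolar)
  next
    case False
    with \<open>b \<ge> 0\<close> have "b > 0" by simp
    have "(1 / b) *\<^sub>R a \<in> dual_face P F"
      unfolding dual_face_def polar_def using ab \<open>b > 0\<close>
      by (auto simp: inner_commute[of _ a] field_simps)
    then have "dual_face (polar P) (dual_face P F) \<subseteq> P \<inter> {x. ((1 / b) *\<^sub>R a) \<bullet> x = 1}"
      unfolding dual_face_def[of "polar P"] bipolar by blast
    also have "\<dots> \<subseteq> F"
      using ab(2) \<open>b > 0\<close> by (auto simp: field_simps)
    finally show ?thesis .
  qed
  moreover have "F \<subseteq> dual_face (polar P) (dual_face P F)"
    using FP unfolding dual_face_def[of "polar P"] bipolar
    by (auto simp: dual_face_def inner_commute)
  ultimately show ?thesis by blast
qed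

theorem dual_polytope_polar:
  assumes P: "polytope P" "0 \<in> P" and bnd: "bounded (polar P)"
  shows "dual_polytope P (polar P)"
proof -
  have bipolar: "polar (polar P) = P"
    by (intro polar_polar polytope_imp_closed polytope_imp_convex P)
  have pol: "polytope (polar P)" by (rule polytope_polar[OF P(1) bnd])
  note inv = dual_face_dual_face[OF P bnd]
  have inv': "dual_face P (dual_face (polar P) G) = G" if "G face_of polar P" for G
    using dual_face_dual_face[OF pol zero_in_polar _ that] bipolar P(1) polytope_imp_bounded
    by force
  have face: "dual_face P F face_of polar P" if "F face_of P" for F
    using that pol face_of_imp_subset polytope_imp_convex dual_face_face_of by blast
  have face': "dual_face (polar P) G face_of P" if "G face_of polar P" for G
    using that dual_face_face_of[of "polar P" G] bipolar P(1) face_of_imp_subset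
      polytope_imp_convex by metis
  have "bij_betw (dual_face P) {F. F face_of P} {G. G face_of polar P}"
    by (rule bij_betw_byWitness[where f' = "dual_face (polar P)"]) (auto simp: inv inv' face face')
  moreover have "F \<subseteq> F' \<longleftrightarrow> dual_face P F' \<subseteq> dual_face P F" if "F face_of P" "F' face_of P" for F F'
    using dual_face_antimono inv that by metis
  ultimately show ?thesis
    unfolding dual_polytope_def using P(1) pol by blast
qed

section \<open>Polytopes whose proper faces form a simplicial complex\<close>

text \<open>If the vertices were affinely dependent, Radon would give two disjoint sets of vertices
  whose hulls meet. Both hulls are faces, so their intersection is a nonempty face, and a vertex of
  it belongs to both sets.\<close>

lemma simplex_if_subsets_span_faces:
  fixes G :: "'a::euclidean_space set"
  assumes "polytope G"
    and faces: "\<And>M. M \<subseteq> {v. v extreme_point_of G} \<Longrightarrow>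
      \<exists>F. F face_of G \<and> {v. v extreme_point_of F} = M"
  shows "\<exists>k. k simplex G"
proof -
  define E where "E = {v. v extreme_point_of G}"
  have KM: "F = convex hull {v. v extreme_point_of F}" if "F face_of G" for F
  proof -
    have "polytope F" using that assms(1) face_of_polytope_polytope by blast
    then show ?thesis
      using Krein_Milman_Minkowski polytope_imp_compact polytope_imp_convex by blast
  qed
  have face: "convex hull M face_of G" "{v. v extreme_point_of convex hull M} = M"
    if "M \<subseteq> E" for M
  proof -
    obtain F where "F face_of G" "{v. v extreme_point_of F} = M"
      using faces \<open>M \<subseteq> E\<close> unfolding E_def by blast
    moreover from this have "F = convex hull M" using KM by metis
    ultimately show "convex hull M face_of G" "{v. v extreme_point_of convex hull M} = M"
      by auto
  qed
  have "\<not> affine_dependent E"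
  proof
    assume "affine_dependent E"
    then obtain M N where MN: "M \<subseteq> E" "N \<subseteq> E" "M \<inter> N = {}"
      "(convex hull M) \<inter> (convex hull N) \<noteq> {}"
      by (rule Radon)
    let ?F = "(convex hull M) \<inter> (convex hull N)"
    have F: "?F face_of G" by (intro face_of_Int face(1) MN(1,2))
    then have "{v. v extreme_point_of ?F} \<noteq> {}"
      using KM[OF F] MN(4) by (metis convex_hull_empty)
    then obtain v where v: "v extreme_point_of ?F" by blast
    have "v extreme_point_of G"
      using v F extreme_point_of_face by blast
    moreover have "v \<in> ?F" using v unfolding extreme_point_of_def by simp
    ultimately have "v extreme_point_of convex hull M" "v extreme_point_of convex hull N"
      using extreme_point_of_face[OF face(1)] MN(1,2) by simp_all
    then have "v \<in> M" "v \<in> N" using face(2) MN(1,2) by auto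
    then show False using MN(3) by blast
  qed
  moreover have "G = convex hull E"
    using KM[of G] assms(1) face_of_refl polytope_imp_convex unfolding E_def by blast
  \<comment> \<open>The dimension is \<open>card E - 1\<close>, taken in the integers so that the
    empty face gets -1.\<close>
  moreover have "int (card E) = (int (card E) - 1) + 1" by simp
  ultimately show ?thesis unfolding simplex_def by blast
qed

text \<open>An abstract isomorphism of posets is made geometric: a singleton \<open>{v}\<close> in
  \<open>K\<close> is an atom, so \<open>\<theta> {v}\<close> is one point \<open>q v\<close>, and
  the extreme points of \<open>\<theta> \<sigma>\<close> are the \<open>q v\<close> with
  \<open>v \<in> \<sigma>\<close>. Every set of extreme points of a proper face then comes from a
  subset of \<sigma> and hence from a face, as the simplex criterion demands.\<close>

theorem simplicial_polytope_if_face_poset_iso: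
  fixes Q :: "'b::euclidean_space set" and K :: "'v set set"
  assumes Q: "polytope Q"
    and down: "\<And>\<sigma> \<tau>. \<sigma> \<in> K \<Longrightarrow> \<tau> \<subseteq> \<sigma> \<Longrightarrow> \<tau> \<in> K" and "K \<noteq> {}"
    and bij: "bij_betw \<theta> K {G. G face_of Q \<and> G \<noteq> Q}"
    and ord: "\<And>\<sigma> \<tau>. \<sigma> \<in> K \<Longrightarrow> \<tau> \<in> K \<Longrightarrow> \<sigma> \<subseteq> \<tau> \<longleftrightarrow> \<theta> \<sigma> \<subseteq> \<theta> \<tau>"
  shows "simplicial_polytope Q \<and> complex_iso K (boundary_complex Q)"
proof -
  have emp: "{} \<in> K" using down \<open>K \<noteq> {}\<close> by blast
  have \<theta>: "\<theta> \<sigma> face_of Q" "\<theta> \<sigma> \<noteq> Q" if "\<sigma> \<in> K" for \<sigma>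
    using bij_betw_apply[OF bij that] by simp_all
  have \<theta>_surj: "\<exists>\<sigma>\<in>K. \<theta> \<sigma> = G" if "G face_of Q" "G \<noteq> Q" for G
  proof -
    have "G \<in> \<theta> ` K"
      unfolding bij_betw_imp_surj_on[OF bij] using that by simp
    then show ?thesis by blast
  qed
  have "Q \<noteq> {}"
    using \<theta>[OF emp] by auto
  then obtain \<tau> where "\<tau> \<in> K" "\<theta> \<tau> = {}"
    using \<theta>_surj[of "{}"] by auto
  then have \<theta>_emp: "\<theta> {} = {}" using ord[OF emp] by auto
  have \<theta>_nonemp: "\<theta> \<sigma> \<noteq> {}" if "\<sigma> \<in> K" "\<sigma> \<noteq> {}" for \<sigma>
    using ord[OF that(1) emp] that(2) \<theta>_emp by auto
  have poly: "polytope (\<theta> \<sigma>)" if "\<sigma> \<in> K" for \<sigma>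
    using \<theta> Q that face_of_polytope_polytope by blast
  have pointface: "\<exists>v. \<sigma> \<supseteq> {v} \<and> {v} \<in> K \<and> \<theta> {v} = {x}"
    if "\<sigma> \<in> K" "x extreme_point_of \<theta> \<sigma>" for \<sigma> x
  proof -
    have x: "{x} face_of \<theta> \<sigma>" using that face_of_singleton by blast
    then have "{x} face_of Q" using \<theta>(1)[OF that(1)] face_of_trans by blast
    moreover have "{x} \<noteq> Q"
      using \<theta>[OF that(1)] x face_of_imp_subset by blast
    ultimately obtain \<tau> where \<tau>: "\<tau> \<in> K" "\<theta> \<tau> = {x}" using \<theta>_surj by blast
    then obtain v where "v \<in> \<tau>" using \<theta>_emp by (cases "\<tau> = {}") auto
    then have "{v} \<in> K" "\<theta> {v} \<subseteq> {x}"
      using down[OF \<tau>(1)] ord[of "{v}" \<tau>] \<tau> by auto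
    then have "\<theta> {v} = {x}" using \<theta>_nonemp by blast
    moreover have "{x} \<subseteq> \<theta> \<sigma>" using x face_of_imp_subset by blast
    ultimately show ?thesis
      using \<open>{v} \<in> K\<close> ord[OF _ that(1)] by metis
  qed
  \<comment> \<open>An extreme point of \<open>\<theta> {v}\<close>, as a face, is the image of a
    singleton contained in \<open>{v}\<close>, so it is all of \<open>\<theta> {v}\<close>.\<close>
  have "\<exists>x. \<theta> {v} = {x}" if "v \<in> \<Union>K" for v
  proof -
    have v: "{v} \<in> K" using down that by auto
    then obtain x where "x extreme_point_of \<theta> {v}"
      using extreme_point_exists_convex[of "\<theta> {v}"] poly \<theta>_nonemp
        polytope_imp_compact polytope_imp_convex by blast
    then show ?thesis using pointface[OF v] by blast
  qed
  then obtain q where q: "\<And>v. v \<in> \<Union>K \<Longrightarrow> \<theta> {v} = {q v}" by metis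
  have ext: "{x. x extreme_point_of \<theta> \<sigma>} = q ` \<sigma>" if \<sigma>: "\<sigma> \<in> K" for \<sigma>
  proof
    show "{x. x extreme_point_of \<theta> \<sigma>} \<subseteq> q ` \<sigma>"
      using pointface[OF \<sigma>] q by force
    show "q ` \<sigma> \<subseteq> {x. x extreme_point_of \<theta> \<sigma>}"
    proof clarify
      fix v assume v: "v \<in> \<sigma>"
      then have vK: "{v} \<in> K" using down[OF \<sigma>] by auto
      then have "{q v} \<subseteq> \<theta> \<sigma>" "{q v} face_of Q"
        using ord[OF vK \<sigma>] v q[OF UnionI[OF \<sigma> v]] \<theta>(1)[OF vK] by auto
      then have "{q v} face_of \<theta> \<sigma>"
        using face_of_subset \<theta>(1)[OF \<sigma>] face_of_imp_subset by blast
      then show "q v extreme_point_of \<theta> \<sigma>" using face_of_singleton by blast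
    qed
  qed
  have "inj_on q (\<Union>K)"
  proof (rule inj_onI)
    fix v w assume vw: "v \<in> \<Union>K" "w \<in> \<Union>K" "q v = q w"
    then have "{v} \<in> K" "{w} \<in> K" "\<theta> {v} = \<theta> {w}" using down q by auto
    then show "v = w" using bij bij_betw_imp_inj_on inj_onD by (metis singleton_inject)
  qed
  moreover have bd: "boundary_complex Q = (\<lambda>\<sigma>. q ` \<sigma>) ` K"
  proof -
    have "boundary_complex Q = (\<lambda>G. {v. v extreme_point_of G}) ` \<theta> ` K"
      unfolding boundary_complex_def bij_betw_imp_surj_on[OF bij] by auto
    also have "\<dots> = (\<lambda>\<sigma>. q ` \<sigma>) ` K"
      unfolding image_image by (rule image_cong) (auto simp: ext)
    finally show ?thesis .
  qed
  ultimately have iso: "complex_iso K (boundary_complex Q)"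
    unfolding complex_iso_def bij_betw_def by (intro exI[of _ q]) auto
  have "\<exists>k. k simplex G" if G: "G face_of Q" "G \<noteq> Q" for G
  proof (rule simplex_if_subsets_span_faces)
    show "polytope G" using G Q face_of_polytope_polytope by blast
    fix M assume M: "M \<subseteq> {v. v extreme_point_of G}"
    obtain \<sigma> where \<sigma>: "\<sigma> \<in> K" "G = \<theta> \<sigma>" using \<theta>_surj G by blast
    then obtain \<tau> where \<tau>: "\<tau> \<subseteq> \<sigma>" "M = q ` \<tau>"
      using M ext[OF \<sigma>(1)] unfolding \<sigma>(2) by (auto simp: subset_image_iff)
    have "\<tau> \<in> K" using down[OF \<sigma>(1) \<tau>(1)] .
    then have "\<theta> \<tau> \<subseteq> G" using ord[OF _ \<sigma>(1)] \<tau>(1) \<sigma>(2) by simp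
    then have "\<theta> \<tau> face_of G"
      using face_of_subset[OF \<theta>(1)[OF \<open>\<tau> \<in> K\<close>]] face_of_imp_subset[OF G(1)] by simp
    then show "\<exists>F. F face_of G \<and> {v. v extreme_point_of F} = M"
      using ext[OF \<open>\<tau> \<in> K\<close>] \<tau>(2) by blast
  qed
  then show ?thesis
    using Q iso unfolding simplicial_polytope_def by blast
qed

section \<open>Faces of the type B permutohedron\<close>

definition sign_vectors :: "(real ^ 'n::finite) set" where
  "sign_vectors = {v. v \<noteq> 0 \<and> (\<forall>i. v $ i \<in> {-1, 0, 1})}"

definition conforms :: "real ^ 'n \<Rightarrow> real ^ 'n \<Rightarrow> bool" where
  "conforms u v \<longleftrightarrow> (\<forall>i. u $ i = 0 \<or> u $ i = v $ i)"

definition supp :: "real ^ 'n \<Rightarrow> 'n set" where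
  "supp v = {i. v $ i \<noteq> 0}"

definition sign_chains :: "(real ^ 'n::finite) set set" where
  "sign_chains = {C. C \<subseteq> sign_vectors \<and> Complete_Partial_Order.chain conforms C}"

lemma conforms_refl: "conforms v v"
  by (simp add: conforms_def)

lemma conforms_trans: "conforms u v \<Longrightarrow> conforms v w \<Longrightarrow> conforms u w"
  unfolding conforms_def by metis

lemma conforms_antisym: "conforms u v \<Longrightarrow> conforms v u \<Longrightarrow> u = v"
  unfolding conforms_def vec_eq_iff by metis

lemma finite_vec_components_in:
  assumes "finite A"
  shows "finite {x :: 'a ^ 'n::finite. \<forall>i. x $ i \<in> A}"
proof -
  have "{x :: 'a ^ 'n. \<forall>i. x $ i \<in> A} \<subseteq> vec_lambda ` (\<Pi>\<^sub>E i\<in>UNIV. A)"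
  proof
    fix x :: "'a ^ 'n" assume "x \<in> {x. \<forall>i. x $ i \<in> A}"
    then have "vec_nth x \<in> (\<Pi>\<^sub>E i\<in>UNIV. A)" by auto
    then show "x \<in> vec_lambda ` (\<Pi>\<^sub>E i\<in>UNIV. A)"
      by (metis image_eqI vec_nth_inverse)
  qed
  then show ?thesis
    by (rule finite_subset) (simp add: assms finite_PiE)
qed

lemma finite_sign_vectors: "finite (sign_vectors :: (real ^ 'n::finite) set)"
  by (rule finite_subset[OF _ finite_vec_components_in[of "{-1, 0, 1}"]])
    (auto simp: sign_vectors_def)

lemma finite_sign_chain: "C \<in> sign_chains \<Longrightarrow> finite C"
  using finite_subset finite_sign_vectors unfolding sign_chains_def by blast

text \<open>A coordinate in the support of \<open>u\<close> contributes at most 1 to the inner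
  product, and exactly 1 only if \<open>v\<close> agrees with \<open>u\<close> there; the others
  contribute 0.\<close>

lemma inner_le_card_supp:
  fixes u v :: "real ^ 'n::finite"
  assumes "\<And>i. u $ i \<in> {-1, 0, 1}" "\<And>i. v $ i \<in> {-1, 0, 1}"
  shows "u \<bullet> v \<le> card (supp u)" "u \<bullet> v = card (supp u) \<longleftrightarrow> conforms u v"
proof -
  let ?d = "\<lambda>i. (if u $ i \<noteq> 0 then 1 else 0) - u $ i * v $ i"
  have d: "?d i \<ge> 0" "?d i = 0 \<longleftrightarrow> u $ i = 0 \<or> u $ i = v $ i" for i
    using assms(1)[of i] assms(2)[of i] by auto
  have "(\<Sum>i\<in>UNIV. if u $ i \<noteq> 0 then 1 else 0) = real (card (supp u))"
    unfolding supp_def by (simp flip: sum.inter_filter)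
  then have *: "card (supp u) - u \<bullet> v = (\<Sum>i\<in>UNIV. ?d i)"
    by (simp add: sum_subtractf inner_vec_def)
  also have "\<dots> \<ge> 0" by (rule sum_nonneg) (use d in blast)
  finally show "u \<bullet> v \<le> card (supp u)" by simp
  have "(\<Sum>i\<in>UNIV. ?d i) = 0 \<longleftrightarrow> (\<forall>i\<in>UNIV. ?d i = 0)"
    by (rule sum_nonneg_eq_0_iff) (use d in auto)
  then have "(\<Sum>i\<in>UNIV. ?d i) = 0 \<longleftrightarrow> conforms u v"
    unfolding conforms_def by (simp only: d(2)) simp
  then show "u \<bullet> v = card (supp u) \<longleftrightarrow> conforms u v"
    using * by auto
qed

section \<open>Supporting inequalities of the permutohedron and their equality cases\<close>

definition signed_perm :: "('n::finite \<Rightarrow> nat) \<Rightarrow> ('n \<Rightarrow> real) \<Rightarrow> bool" where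
  "signed_perm p s \<longleftrightarrow> bij_betw p UNIV {1..CARD('n)} \<and> (\<forall>i. s i \<in> {1, -1})"

definition signed_perm_point :: "('n::finite \<Rightarrow> nat) \<Rightarrow> ('n \<Rightarrow> real) \<Rightarrow> real ^ 'n" where
  "signed_perm_point p s = (\<chi> i. s i * real (p i))"

text \<open>Threshold slices of a vertex: \<open>s i * p i\<close> is a sum of \<open>p i\<close>
  copies of \<open>s i\<close>, so the vertex is the sum of its layers, which shrink as
  \<open>m\<close> grows.\<close>

definition layer :: "('n::finite \<Rightarrow> nat) \<Rightarrow> ('n \<Rightarrow> real) \<Rightarrow> nat \<Rightarrow> real ^ 'n" where
  "layer p s m = (\<chi> i. if m \<le> p i then s i else 0)"

text \<open>With \<open>k = card (supp v)\<close> this is the sum of the \<open>k\<close> largest numbers in $[1,n]$, written as a sum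
  over the layers of a signed permutation so that each summand can be bounded separately.\<close>

definition height :: "real ^ 'n::finite \<Rightarrow> real" where
  "height v = (\<Sum>m = 1..CARD('n). real (min (card (supp v)) (CARD('n) + 1 - m)))"

lemma perm_B_eq_hull:
  "perm_B = convex hull {signed_perm_point p s | p s. signed_perm p s}"
  unfolding perm_B_def signed_perm_def signed_perm_point_def
  by (rule arg_cong[where f = "\<lambda>V. convex hull V"]) auto

lemma signed_perm_point_in_perm_B: "signed_perm p s \<Longrightarrow> signed_perm_point p s \<in> perm_B"
  unfolding perm_B_eq_hull by (rule hull_inc) auto

lemma signed_perm_range:
  assumes "signed_perm (p :: 'n::finite \<Rightarrow> nat) s"
  shows "1 \<le> p i" "p i \<le> CARD('n)"
  using assms bij_betwE[of p UNIV "{1..CARD('n)}"] unfolding signed_perm_def by auto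

lemma polytope_perm_B: "polytope (perm_B :: (real ^ 'n::finite) set)"
proof -
  let ?A = "(\<lambda>k. real k) ` {..CARD('n)} \<union> (\<lambda>k. - real k) ` {..CARD('n)}"
  have "{signed_perm_point p s | p s. signed_perm p s} \<subseteq> {x :: real ^ 'n. \<forall>i. x $ i \<in> ?A}"
  proof (intro subsetI CollectI allI)
    fix x :: "real ^ 'n" and i
    assume "x \<in> {signed_perm_point p s | p s. signed_perm p s}"
    then obtain p s where ps: "x = signed_perm_point p s" "signed_perm p s" by blast
    have "p i \<le> CARD('n)" "s i = 1 \<or> s i = -1"
      using signed_perm_range[OF ps(2)] ps(2) unfolding signed_perm_def by auto
    then show "x $ i \<in> ?A"
      by (auto simp: ps(1) signed_perm_point_def)
  qed
  then have "finite {signed_perm_point p s | p s. signed_perm (p :: 'n \<Rightarrow> nat) s}"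
    by (rule finite_subset) (rule finite_vec_components_in, simp)
  then show ?thesis unfolding perm_B_eq_hull by (rule polytope_convex_hull)
qed

lemma signed_perm_point_eq_sum_layers:
  assumes "signed_perm (p :: 'n::finite \<Rightarrow> nat) s"
  shows "signed_perm_point p s = (\<Sum>m = 1..CARD('n). layer p s m)"
proof -
  have "{m \<in> {1..CARD('n)}. m \<le> p i} = {1..p i}" for i
    using signed_perm_range[OF assms, of i] by auto
  then have "(\<Sum>m = 1..CARD('n). if m \<le> p i then s i else 0) = s i * real (p i)" for i
    by (simp flip: sum.inter_filter)
  then show ?thesis
    by (simp add: vec_eq_iff signed_perm_point_def layer_def)
qed

lemma layer_components: "signed_perm p s \<Longrightarrow> layer p s m $ i \<in> {-1, 0, 1}"
  by (auto simp: layer_def signed_perm_def)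

lemma conforms_layer: "m \<le> m' \<Longrightarrow> conforms (layer p s m') (layer p s m)"
  by (auto simp: layer_def conforms_def)

lemma card_supp_layer:
  assumes "signed_perm (p :: 'n::finite \<Rightarrow> nat) s" "1 \<le> m"
  shows "card (supp (layer p s m)) = CARD('n) + 1 - m"
proof -
  have bij: "bij_betw p UNIV {1..CARD('n)}" and s: "\<And>i. s i \<in> {1, -1}"
    using assms unfolding signed_perm_def by blast+
  have "s i \<noteq> 0" for i using s[of i] by auto
  then have supp: "supp (layer p s m) = {i. m \<le> p i}"
    by (simp add: supp_def layer_def)
  have "p ` {i. m \<le> p i} = {j \<in> p ` UNIV. m \<le> j}" by auto
  also have "\<dots> = {m..CARD('n)}"
    using bij_betw_imp_surj_on[OF bij] assms(2) by auto
  finally have "bij_betw p {i. m \<le> p i} {m..CARD('n)}"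
    using bij_betw_subset[OF bij] by blast
  then show ?thesis using supp bij_betw_same_card by fastforce
qed

text \<open>Each layer contributes at most the size of the smaller of the two supports, and these
  bounds add up to \<open>height v\<close>. Equality must hold in every term; at the layer with as
  many nonzero coordinates as \<open>v\<close> it makes each vector conform to the other.
  Conversely, a layer is comparable with all layers, which gives equality throughout.\<close>

lemma inner_signed_perm_point_le_height:
  fixes v :: "real ^ 'n::finite"
  assumes ps: "signed_perm p s" and v: "v \<in> sign_vectors"
  shows "v \<bullet> signed_perm_point p s \<le> height v"
    "v \<bullet> signed_perm_point p s = height v \<longleftrightarrow> (\<exists>m\<in>{1..CARD('n)}. v = layer p s m)"
proof -
  let ?l = "layer p s" and ?N = "CARD('n)"
  let ?h = "\<lambda>m. real (min (card (supp v)) (?N + 1 - m))"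
  have vc: "\<And>i. v $ i \<in> {-1, 0, 1}" and "v \<noteq> 0"
    using v unfolding sign_vectors_def by auto
  note le = inner_le_card_supp[OF vc layer_components[OF ps]]
    inner_le_card_supp[OF layer_components[OF ps] vc]
  have sum: "v \<bullet> signed_perm_point p s = (\<Sum>m = 1..?N. v \<bullet> ?l m)"
    by (simp add: signed_perm_point_eq_sum_layers[OF ps] inner_sum_right)
  have term_le: "v \<bullet> ?l m \<le> ?h m" if "m \<in> {1..?N}" for m
    using le(1)[of m] le(3)[of m] card_supp_layer[OF ps, of m] that
    by (simp add: inner_commute)
  show "v \<bullet> signed_perm_point p s \<le> height v"
    unfolding sum height_def by (rule sum_mono) (rule term_le)
  have eq: "v \<bullet> signed_perm_point p s = height v \<longleftrightarrow> (\<forall>m\<in>{1..?N}. v \<bullet> ?l m = ?h m)"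
  proof -
    have "(\<Sum>m = 1..?N. ?h m - v \<bullet> ?l m) = 0 \<longleftrightarrow> (\<forall>m\<in>{1..?N}. ?h m - v \<bullet> ?l m = 0)"
      by (rule sum_nonneg_eq_0_iff) (use term_le in auto)
    then show ?thesis
      unfolding sum height_def sum_subtractf right_minus_eq by metis
  qed
  show "v \<bullet> signed_perm_point p s = height v \<longleftrightarrow> (\<exists>m\<in>{1..?N}. v = ?l m)"
  proof
    assume tight: "v \<bullet> signed_perm_point p s = height v"
    \<comment> \<open>Chosen so that layer \<open>m\<close> has a support of the same size as
      \<open>v\<close>.\<close>
    define m where "m = ?N + 1 - card (supp v)"
    have "supp v \<noteq> {}" using \<open>v \<noteq> 0\<close> by (simp add: supp_def vec_eq_iff)
    then have card: "1 \<le> card (supp v)" "card (supp v) \<le> ?N"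
      by (auto simp: Suc_le_eq card_gt_0_iff intro: card_mono)
    then have m: "m \<in> {1..?N}" "?N + 1 - m = card (supp v)"
      by (auto simp: m_def)
    then have "v \<bullet> ?l m = card (supp v)" using tight eq by force
    moreover have "card (supp (?l m)) = card (supp v)"
      using card_supp_layer[OF ps, of m] m by simp
    ultimately have "conforms v (?l m)" "conforms (?l m) v"
      using le(2)[of m] le(4)[of m] by (auto simp: inner_commute)
    then show "\<exists>m\<in>{1..?N}. v = ?l m"
      using conforms_antisym m(1) by blast
  next
    assume "\<exists>m\<in>{1..?N}. v = ?l m"
    then obtain k where k: "k \<in> {1..?N}" "v = ?l k" by blast
    have "v \<bullet> ?l m = ?h m" if m: "m \<in> {1..?N}" for m
    proof (cases "m \<le> k")
      case True
      then have "conforms v (?l m)" unfolding k(2) by (rule conforms_layer)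
      then have "v \<bullet> ?l m = card (supp v)" using le(2) by blast
      then show ?thesis using card_supp_layer[OF ps, of k] k True by simp
    next
      case False
      then have "conforms (?l m) v" unfolding k(2) by (intro conforms_layer) simp
      then have "?l m \<bullet> v = card (supp (?l m))" using le(4) by blast
      then show ?thesis
        using card_supp_layer[OF ps, of k] card_supp_layer[OF ps, of m] k m False
        by (simp add: inner_commute)
    qed
    then show "v \<bullet> signed_perm_point p s = height v" using eq by blast
  qed
qed

lemma inner_perm_B_le_height:
  fixes v :: "real ^ 'n::finite"
  assumes "v \<in> sign_vectors" "x \<in> perm_B"
  shows "v \<bullet> x \<le> height v"
proof -
  have "{signed_perm_point p s | p s. signed_perm p s} \<subseteq> {x. v \<bullet> x \<le> height v}"
    using inner_signed_perm_point_le_height(1) assms(1) by blast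
  then have "perm_B \<subseteq> {x. v \<bullet> x \<le> height v}"
    unfolding perm_B_eq_hull by (rule hull_minimal) (rule convex_halfspace_le)
  then show ?thesis using assms(2) by blast
qed

text \<open>Both vectors are layers of the same signed permutation. The use is contrapositive: a
  tight vector prevents any incomparable one from being tight at the same vertex.\<close>

lemma tight_comparable:
  assumes "signed_perm p s" "u \<in> sign_vectors" "v \<in> sign_vectors"
    and "u \<bullet> signed_perm_point p s = height u" "v \<bullet> signed_perm_point p s = height v"
  shows "conforms u v \<or> conforms v u"
proof -
  obtain k l where "u = layer p s k" "v = layer p s l"
    using assms inner_signed_perm_point_le_height(2) by metis
  then show ?thesis using conforms_layer by (metis nle_le)
qed

section \<open>A vertex at which a whole chain of inequalities is tight\<close>

text \<open>A ranking with ties broken arbitrarily: elements are added by nondecreasing key, and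
  each new one receives the next number.\<close>

lemma ex_bij_betw_strict_mono_key:
  fixes g :: "'a \<Rightarrow> nat"
  assumes "finite A"
  shows "\<exists>p. bij_betw p A {1..card A} \<and> (\<forall>i\<in>A. \<forall>j\<in>A. g i < g j \<longrightarrow> p i < p j)"
  using assms
proof (induction A rule: finite_ranking_induct[where f = g])
  case empty
  then show ?case by (auto simp: bij_betw_def)
next
  case (insert x S)
  show ?case
  proof (cases "x \<in> S")
    case True
    then show ?thesis using insert.IH by (simp add: insert_absorb)
  next
    case False
    obtain p where p: "bij_betw p S {1..card S}" "\<forall>i\<in>S. \<forall>j\<in>S. g i < g j \<longrightarrow> p i < p j"
      using insert.IH by blast
    let ?p = "p(x := Suc (card S))"
    have "bij_betw ?p S {1..card S}"
      using p(1) by (rule bij_betw_cong[THEN iffD1, rotated]) (use False in auto)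
    moreover have "bij_betw ?p {x} {Suc (card S)}" by auto
    ultimately have "bij_betw ?p (S \<union> {x}) ({1..card S} \<union> {Suc (card S)})"
      by (rule bij_betw_combine) auto
    moreover have "{1..card S} \<union> {Suc (card S)} = {1..card (insert x S)}"
      using False insert.hyps(1) by auto
    ultimately have "bij_betw ?p (insert x S) {1..card (insert x S)}" by simp
    moreover have "?p i < ?p j" if "i \<in> insert x S" "j \<in> insert x S" "g i < g j" for i j
    proof -
      have "i \<noteq> x" using that insert.hyps(2) by force
      then have "i \<in> S" using that by blast
      then have "p i \<le> card S" using p(1) bij_betwE by fastforce
      then show ?thesis using \<open>i \<in> S\<close> \<open>i \<noteq> x\<close> that p(2) by auto
    qed
    ultimately show ?thesis by blast
  qed
qed

text \<open>Turns an upward closed set of values into a threshold known from its cardinality; this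
  identifies the support of a chain member with that of a layer.\<close>

lemma upward_closed_eq_atLeastAtMost:
  assumes "U \<subseteq> {1..n::nat}" and up: "\<And>a b. a \<in> U \<Longrightarrow> b \<in> {1..n} \<Longrightarrow> a \<le> b \<Longrightarrow> b \<in> U"
  shows "U = {n + 1 - card U..n}"
proof (cases "U = {}")
  case False
  have "finite U" using assms(1) finite_subset by blast
  then have Min: "Min U \<in> U" "\<And>a. a \<in> U \<Longrightarrow> Min U \<le> a" using False by auto
  have "U = {Min U..n}"
  proof
    show "U \<subseteq> {Min U..n}" using Min assms(1) by auto
    show "{Min U..n} \<subseteq> U"
    proof
      fix b assume b: "b \<in> {Min U..n}"
      have "1 \<le> Min U" using Min(1) assms(1) by auto
      then show "b \<in> U" using up[OF Min(1), of b] b by auto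
    qed
  qed
  moreover have "Min U \<le> n" using Min(1) assms(1) by auto
  ultimately have "n + 1 - card U = Min U" using card_atLeastAtMost[of "Min U" n] by simp
  then show ?thesis using \<open>U = {Min U..n}\<close> by simp
qed auto

text \<open>Coordinates that are nonzero in more members of the chain receive larger values, so the
  support of each member consists of the coordinates with the largest values. Signs are consistent
  because comparable vectors agree where both are nonzero. Hence every member is a layer.\<close>

lemma ex_signed_perm_tight:
  fixes C :: "(real ^ 'n::finite) set"
  assumes "C \<in> sign_chains"
  shows "\<exists>p s. signed_perm p s \<and> (\<forall>v\<in>C. v \<bullet> signed_perm_point p s = height v)"
proof -
  have C: "C \<subseteq> sign_vectors"
    and chain: "\<And>u v. u \<in> C \<Longrightarrow> v \<in> C \<Longrightarrow> conforms u v \<or> conforms v u"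
    using assms unfolding sign_chains_def chain_def by auto
  have fin: "finite C" using assms by (rule finite_sign_chain)
  define g where "g i = card {v \<in> C. v $ i \<noteq> 0}" for i
  obtain p where p: "bij_betw p UNIV {1..CARD('n)}" "\<And>i j. g i < g j \<Longrightarrow> p i < p j"
    using ex_bij_betw_strict_mono_key[of UNIV g] by auto
  \<comment> \<open>A coordinate that vanishes throughout the chain may carry either sign; 1 is the
    default.\<close>
  define s where "s i = (if \<exists>v\<in>C. v $ i \<noteq> 0 then (SOME r. \<exists>v\<in>C. v $ i = r \<and> r \<noteq> 0) else 1)" for i
  have s: "s i = v $ i" if "v \<in> C" "v $ i \<noteq> 0" for v i
  proof -
    let ?P = "\<lambda>r. \<exists>v\<in>C. v $ i = r \<and> r \<noteq> 0"
    have "?P (v $ i)" using that by blast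
    then have "?P (SOME r. ?P r)" by (rule someI)
    moreover have "s i = (SOME r. ?P r)" using that unfolding s_def by auto
    ultimately obtain u where "u \<in> C" "u $ i = s i" "s i \<noteq> 0" by auto
    then show ?thesis using chain[of u v] that unfolding conforms_def by metis
  qed
  have "s i \<in> {1, -1}" for i
  proof (cases "\<exists>v\<in>C. v $ i \<noteq> 0")
    case True
    then obtain v where "v \<in> C" "v $ i \<noteq> 0" by blast
    then show ?thesis using s[of v i] C unfolding sign_vectors_def by auto
  next
    case False
    then have "s i = 1" unfolding s_def by (rule if_not_P)
    then show ?thesis by simp
  qed
  then have ps: "signed_perm p s" using p(1) unfolding signed_perm_def by blast
  have "\<exists>m\<in>{1..CARD('n)}. v = layer p s m" if v: "v \<in> C" for v
  proof -
    \<comment> \<open>A member that is nonzero at \<open>j\<close>, where \<open>v\<close> vanishes,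
      lies above \<open>v\<close> and so is nonzero at \<open>i\<close> too. As \<open>v\<close>
      itself counts for \<open>i\<close> only, the key of \<open>i\<close> is strictly
      larger.\<close>
    have lt: "p j < p i" if "i \<in> supp v" "j \<notin> supp v" for i j
    proof -
      have "u $ i \<noteq> 0" if "u \<in> C" "u $ j \<noteq> 0" for u
      proof -
        have "\<not> conforms u v"
          using that \<open>j \<notin> supp v\<close> unfolding conforms_def supp_def by auto
        then have "conforms v u" using chain[OF that(1) v] by blast
        then show ?thesis using \<open>i \<in> supp v\<close> unfolding conforms_def supp_def by auto
      qed
      then have "{u \<in> C. u $ j \<noteq> 0} \<subset> {u \<in> C. u $ i \<noteq> 0}"
        using v that unfolding supp_def by blast
      then have "g j < g i" unfolding g_def using fin by (intro psubset_card_mono) auto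
      then show ?thesis by (rule p(2))
    qed
    let ?m = "CARD('n) + 1 - card (supp v)"
    have inj: "inj p" using p(1) bij_betw_imp_inj_on by blast
    have "p ` supp v = {CARD('n) + 1 - card (p ` supp v)..CARD('n)}"
    proof (rule upward_closed_eq_atLeastAtMost)
      show "p ` supp v \<subseteq> {1..CARD('n)}" using signed_perm_range[OF ps] by auto
      fix a b assume a: "a \<in> p ` supp v" and b: "b \<in> {1..CARD('n)}" and "a \<le> b"
      obtain j where j: "b = p j" using b unfolding bij_betw_imp_surj_on[OF p(1), symmetric] by blast
      have "j \<in> supp v"
      proof (rule ccontr)
        assume "j \<notin> supp v"
        then have "b < a" using lt a j by auto
        then show False using \<open>a \<le> b\<close> by simp
      qed
      then show "b \<in> p ` supp v" using j by blast
    qed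
    moreover have "card (p ` supp v) = card (supp v)"
      using inj by (simp add: card_image inj_on_def)
    ultimately have im: "p ` supp v = {?m..CARD('n)}" by simp
    have supp: "i \<in> supp v \<longleftrightarrow> ?m \<le> p i" for i
    proof -
      have "i \<in> supp v \<longleftrightarrow> p i \<in> p ` supp v" using inj by (simp add: inj_image_mem_iff)
      then show ?thesis unfolding im using signed_perm_range[OF ps, of i] by auto
    qed
    have "v = layer p s ?m"
    proof (unfold vec_eq_iff, rule allI)
      fix i
      show "v $ i = layer p s ?m $ i"
        using s[OF v, of i] supp[of i] by (cases "v $ i = 0") (simp_all add: layer_def supp_def)
    qed
    moreover have "v \<noteq> 0" using v C unfolding sign_vectors_def by blast
    then have "supp v \<noteq> {}" by (simp add: supp_def vec_eq_iff)
    then have "1 \<le> card (supp v)" "card (supp v) \<le> CARD('n)"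
      by (auto simp: Suc_le_eq card_gt_0_iff intro: card_mono)
    then have "?m \<in> {1..CARD('n)}" by auto
    ultimately show ?thesis by blast
  qed
  then show ?thesis
    using ps inner_signed_perm_point_le_height(2)[OF ps] C by blast
qed

section \<open>Faces attached to chains, and why different chains give different faces\<close>

text \<open>The empty chain yields the polytope itself, so chains account for all nonempty faces and
  not only for the proper ones.\<close>

definition chain_face :: "(real ^ 'n::finite) set \<Rightarrow> (real ^ 'n) set" where
  "chain_face C = {x \<in> perm_B. \<forall>v\<in>C. v \<bullet> x = height v}"

lemma chain_face_face_of:
  assumes "C \<subseteq> sign_vectors"
  shows "chain_face C face_of perm_B"
proof (cases "C = {}")
  case True
  then show ?thesis
    by (simp add: chain_face_def face_of_refl polytope_imp_convex polytope_perm_B)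
next
  case False
  have "chain_face C = (\<Inter>v\<in>C. perm_B \<inter> {x. v \<bullet> x = height v})"
    using False unfolding chain_face_def by auto
  moreover have "perm_B \<inter> {x. v \<bullet> x = height v} face_of perm_B" if "v \<in> C" for v
  proof (rule face_of_Int_supporting_hyperplane_le)
    show "convex perm_B" by (rule polytope_imp_convex[OF polytope_perm_B])
    show "v \<bullet> x \<le> height v" if "x \<in> perm_B" for x
      using inner_perm_B_le_height assms \<open>v \<in> C\<close> that by blast
  qed
  ultimately show ?thesis
    using False face_of_Inter[of "(\<lambda>v. perm_B \<inter> {x. v \<bullet> x = height v}) ` C" perm_B] by auto
qed

lemma chain_face_nonempty:
  assumes "C \<in> sign_chains"
  shows "chain_face C \<noteq> {}"
proof -
  obtain p s where "signed_perm p s" "\<forall>v\<in>C. v \<bullet> signed_perm_point p s = height v"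
    using ex_signed_perm_tight[OF assms] by blast
  then have "signed_perm_point p s \<in> chain_face C"
    using signed_perm_point_in_perm_B unfolding chain_face_def by blast
  then show ?thesis by blast
qed

text \<open>Stated for a general relation because it is applied to \<open>conforms\<close> and also
  to its converse, where it yields a least element.\<close>

lemma finite_chain_greatest:
  assumes "finite A" "A \<noteq> {}" and chain: "Complete_Partial_Order.chain R A"
    and R: "reflp R" "transp R"
  shows "\<exists>a\<in>A. \<forall>c\<in>A. R c a"
  using assms(1-3)
proof (induction A rule: finite_ne_induct)
  case (singleton x)
  then show ?case using R(1) by (auto dest: reflpD)
next
  case (insert x A)
  then obtain a where a: "a \<in> A" "\<forall>c\<in>A. R c a" by (auto simp: chain_def)
  have "R x a \<or> R a x" using insert.prems a(1) by (auto simp: chain_def)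
  then show ?case
  proof
    assume "R a x"
    then have "\<forall>c\<in>insert x A. R c x" using a R by (auto dest: reflpD transpD)
    then show ?thesis by blast
  qed (use a in blast)
qed

text \<open>A gap in a chain of sign vectors never has a unique filling. Let \<open>a\<close> be the
  largest member below \<open>v\<close>, or 0, and \<open>b\<close> the smallest member above
  \<open>v\<close>. Without any \<open>b\<close>, a sign of \<open>v\<close> is flipped at a
  coordinate where \<open>a\<close> vanishes; otherwise \<open>a\<close> is extended by a coordinate
  of \<open>b\<close> at which \<open>v\<close> vanishes.\<close>

lemma ex_sign_vector_incomparable:
  fixes v :: "real ^ 'n::finite"
  assumes C: "C \<in> sign_chains" and v: "v \<in> sign_vectors" "v \<notin> C"
    and comp: "\<And>c. c \<in> C \<Longrightarrow> conforms c v \<or> conforms v c"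
  shows "\<exists>u\<in>sign_vectors. \<not> conforms u v \<and> \<not> conforms v u \<and>
    (\<forall>c\<in>C. conforms c u \<or> conforms u c)"
proof -
  have Cs: "C \<subseteq> sign_vectors" and chain: "Complete_Partial_Order.chain conforms C"
    and fin: "finite C"
    using C finite_sign_chain unfolding sign_chains_def by auto
  have po: "reflp conforms" "transp conforms"
    using conforms_refl conforms_trans by (blast intro: reflpI transpI)+
  \<comment> \<open>Adding 0, which is no sign vector, provides a lower neighbour even if no member
    of \<open>C\<close> lies below \<open>v\<close>.\<close>
  let ?L = "insert 0 {c \<in> C. conforms c v}"
  have "conforms 0 w" for w :: "real ^ 'n" by (simp add: conforms_def)
  then have "Complete_Partial_Order.chain conforms ?L"
    using chain unfolding chain_def by auto
  then obtain a where a: "a \<in> ?L" "\<forall>c\<in>?L. conforms c a"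
    using finite_chain_greatest[of ?L conforms] fin po by auto
  have av: "conforms a v" using a(1) by (auto simp: conforms_def)
  moreover have "a \<noteq> v" using a(1) v unfolding sign_vectors_def by auto
  ultimately obtain j where j: "v $ j \<noteq> 0" "a $ j = 0"
    unfolding conforms_def vec_eq_iff by metis
  have ac: "a $ i \<in> {-1, 0, 1}" for i
    using a(1) Cs unfolding sign_vectors_def by auto
  let ?B = "{c \<in> C. conforms v c}"
  show ?thesis
  proof (cases "?B = {}")
    case True
    \<comment> \<open>At \<open>j\<close> the entries of \<open>u\<close> and \<open>v\<close> are
      nonzero and opposite. Every member of \<open>C\<close> lies below \<open>a\<close>, so it
      vanishes at \<open>j\<close> and still conforms to \<open>u\<close>.\<close>
    define u where "u = (\<chi> k. if k = j then - v $ j else v $ k)"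
    have "u $ j \<noteq> 0" using j by (simp add: u_def)
    then have "u \<noteq> 0" by auto
    then have "u \<in> sign_vectors"
      using v(1) unfolding sign_vectors_def by (auto simp: u_def)
    moreover have "\<not> conforms u v" "\<not> conforms v u"
      using j unfolding conforms_def u_def by auto
    moreover have "conforms c u" if "c \<in> C" for c
    proof -
      have c: "conforms c v" "conforms c a" using comp that True a(2) by auto
      then have "c $ j = 0" using j unfolding conforms_def by metis
      then show ?thesis using c unfolding conforms_def u_def by auto
    qed
    ultimately show ?thesis by blast
  next
    case False
    have "\<exists>b\<in>?B. \<forall>c\<in>?B. conforms\<inverse>\<inverse> c b"
    proof (rule finite_chain_greatest)
      show "Complete_Partial_Order.chain conforms\<inverse>\<inverse> ?B"
        using chain unfolding chain_def by auto
      show "reflp conforms\<inverse>\<inverse>" "transp conforms\<inverse>\<inverse>"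
        using conforms_refl conforms_trans by (auto intro!: reflpI transpI)
    qed (use fin False in auto)
    then obtain b where b: "b \<in> ?B" "\<forall>c\<in>?B. conforms b c"
      by auto
    then have "conforms v b" "b \<noteq> v" using v by auto
    then obtain i where i: "b $ i \<noteq> 0" "v $ i = 0"
      unfolding conforms_def vec_eq_iff by metis
    \<comment> \<open>Nonzero at \<open>i\<close>, where \<open>v\<close> vanishes, and zero at
      \<open>j\<close>, where \<open>v\<close> does not, hence incomparable with \<open>v\<close>;
      yet it still lies between \<open>a\<close> and \<open>b\<close>.\<close>
    define u where "u = (\<chi> k. if k = i then b $ i else a $ k)"
    have "u $ i \<noteq> 0" "b $ i \<in> {-1, 0, 1}"
      using i b(1) Cs unfolding u_def sign_vectors_def by auto
    then have "u \<noteq> 0" by auto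
    then have "u \<in> sign_vectors"
      using ac \<open>b $ i \<in> {-1, 0, 1}\<close> unfolding sign_vectors_def by (auto simp: u_def)
    moreover have "u $ i \<noteq> v $ i" using i by (simp add: u_def)
    then have "\<not> conforms u v" using \<open>u $ i \<noteq> 0\<close> unfolding conforms_def by blast
    moreover have "u $ j = 0" using i j by (auto simp: u_def)
    then have "\<not> conforms v u" using j unfolding conforms_def by metis
    moreover have "conforms c u \<or> conforms u c" if "c \<in> C" for c
    proof (cases "conforms c v")
      case True
      then have "conforms c a" using a(2) that by blast
      moreover have "a $ i = 0" using av i unfolding conforms_def by metis
      then have "conforms a u" unfolding conforms_def u_def by auto
      ultimately show ?thesis using conforms_trans by blast
    next
      case False
      then have "conforms b c" using b(2) comp that by blast
      moreover have "conforms a b" using av \<open>conforms v b\<close> conforms_trans by blast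
      then have "conforms u b" unfolding conforms_def u_def by auto
      ultimately show ?thesis using conforms_trans by blast
    qed
    ultimately show ?thesis by blast
  qed
qed

text \<open>For \<open>v\<close> in \<open>C\<close> but not in \<open>C'\<close>, the face of
  \<open>C'\<close> needs a vertex at which \<open>v\<close> is not tight. It suffices that some
  vector incomparable with \<open>v\<close> is tight there.\<close>

lemma chain_face_subset_iff:
  assumes C: "C \<in> sign_chains" and C': "C' \<in> sign_chains"
  shows "chain_face C' \<subseteq> chain_face C \<longleftrightarrow> C \<subseteq> C'"
proof
  show "C \<subseteq> C' \<Longrightarrow> chain_face C' \<subseteq> chain_face C"
    unfolding chain_face_def by blast
  assume sub: "chain_face C' \<subseteq> chain_face C"
  show "C \<subseteq> C'"
  proof (rule ccontr)
    assume "\<not> C \<subseteq> C'"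
    then obtain v where vC: "v \<in> C" and nv: "v \<notin> C'" by blast
    have v: "v \<in> sign_vectors" using C vC unfolding sign_chains_def by blast
    \<comment> \<open>If \<open>v\<close> is comparable with all of \<open>C'\<close>, an
      incomparable \<open>u\<close> is adjoined to \<open>C'\<close>; otherwise a member of
      \<open>C'\<close> already serves as \<open>u\<close>.\<close>
    have "\<exists>u D. D \<in> sign_chains \<and> C' \<subseteq> D \<and> u \<in> D \<and> \<not> conforms u v \<and> \<not> conforms v u"
    proof (cases "\<forall>c\<in>C'. conforms c v \<or> conforms v c")
      case True
      then obtain u where u: "u \<in> sign_vectors" "\<not> conforms u v" "\<not> conforms v u"
        "\<forall>c\<in>C'. conforms c u \<or> conforms u c"
        using ex_sign_vector_incomparable[OF C' v nv] by blast
      then have "insert u C' \<in> sign_chains"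
        using C' conforms_refl unfolding sign_chains_def chain_def by blast
      then show ?thesis using u by blast
    qed (use C' in blast)
    then obtain u D where D: "D \<in> sign_chains" "C' \<subseteq> D" "u \<in> D"
      and u: "\<not> conforms u v" "\<not> conforms v u" by blast
    obtain p s where ps: "signed_perm p s"
      "\<forall>v\<in>D. v \<bullet> signed_perm_point p s = height v"
      using ex_signed_perm_tight[OF D(1)] by blast
    then have "signed_perm_point p s \<in> chain_face C'"
      using D(2) signed_perm_point_in_perm_B unfolding chain_face_def by blast
    then have "v \<bullet> signed_perm_point p s = height v"
      using sub vC unfolding chain_face_def by blast
    moreover have "u \<in> sign_vectors" using D unfolding sign_chains_def by blast
    ultimately show False
      using tight_comparable[OF ps(1) _ v] ps(2) D(3) u by blast
  qed
qed

section \<open>Every nonempty face comes from a chain\<close>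

text \<open>Subtracting the sign vector of \<open>c\<close>, scaled by the smallest nonzero absolute
  value, kills a coordinate and flips no sign; the rest is induction on the support. That all
  members conform to the sign vector of \<open>c\<close> is carried along so that the enlarged
  family remains a chain.\<close>

lemma positive_sum_of_sign_chain:
  fixes c :: "real ^ 'n::finite"
  shows "\<exists>C \<mu>. C \<in> sign_chains \<and> (\<forall>v\<in>C. \<mu> v > 0 \<and> conforms v (\<chi> i. sgn (c $ i))) \<and>
    c = (\<Sum>v\<in>C. \<mu> v *\<^sub>R v)"
proof (induction "card (supp c)" arbitrary: c rule: less_induct)
  case less
  show ?case
  proof (cases "c = 0")
    case True
    then show ?thesis by (intro exI[of _ "{}"]) (auto simp: sign_chains_def chain_def)
  next
    case False
    define v where "v = (\<chi> i. sgn (c $ i))"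
    define t where "t = Min ((\<lambda>i. \<bar>c $ i\<bar>) ` supp c)"
    define c' where "c' = c - t *\<^sub>R v"
    have ne: "supp c \<noteq> {}" using False by (auto simp: supp_def vec_eq_iff)
    then have "t \<in> (\<lambda>i. \<bar>c $ i\<bar>) ` supp c" unfolding t_def by (intro Min_in) auto
    then obtain k where k: "c $ k \<noteq> 0" "t = \<bar>c $ k\<bar>" by (auto simp: supp_def)
    have t_le: "t \<le> \<bar>c $ i\<bar>" if "c $ i \<noteq> 0" for i
      unfolding t_def using that by (intro Min_le) (auto simp: supp_def)
    have t: "t > 0" using k by simp
    have c'k: "c' $ k = 0"
      using k by (simp add: c'_def v_def sgn_if)
    have sgn: "sgn (c' $ i) = 0 \<or> sgn (c' $ i) = sgn (c $ i)" for i
      using t_le[of i] t by (cases "c $ i = 0") (auto simp: c'_def v_def sgn_if)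
    have "supp c' \<subseteq> supp c" using sgn by (force simp: supp_def sgn_0_0)
    moreover have "k \<in> supp c - supp c'" using k c'k by (simp add: supp_def)
    ultimately have "card (supp c') < card (supp c)"
      by (intro psubset_card_mono) auto
    then obtain C \<mu> where C: "C \<in> sign_chains"
      "\<And>w. w \<in> C \<Longrightarrow> \<mu> w > 0 \<and> conforms w (\<chi> i. sgn (c' $ i))"
      "c' = (\<Sum>w\<in>C. \<mu> w *\<^sub>R w)"
      using less by blast
    have "conforms (\<chi> i. sgn (c' $ i)) v"
      using sgn unfolding conforms_def v_def by auto
    then have conf: "conforms w v" if "w \<in> C" for w
      using C(2)[OF that] conforms_trans by blast
    have "v \<noteq> 0" using k(1) by (auto simp: v_def vec_eq_iff sgn_0_0)
    then have "v \<in> sign_vectors" by (auto simp: sign_vectors_def v_def sgn_if)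
    then have chain: "insert v C \<in> sign_chains"
      using C(1) conf conforms_refl unfolding sign_chains_def chain_def by blast
    \<comment> \<open>Every member of \<open>C\<close> vanishes at \<open>k\<close> because the
      remainder does, whereas \<open>v\<close> is nonzero there.\<close>
    have "v \<notin> C"
    proof
      assume "v \<in> C"
      then have "v $ k = 0 \<or> v $ k = sgn (c' $ k)" using C(2) unfolding conforms_def by force
      then show False using c'k k(1) by (simp add: v_def sgn_0_0)
    qed
    have "c = t *\<^sub>R v + (\<Sum>w\<in>C. \<mu> w *\<^sub>R w)"
      unfolding C(3)[symmetric] by (simp add: c'_def)
    also have "\<dots> = (\<Sum>w\<in>insert v C. (\<mu>(v := t)) w *\<^sub>R w)"
    proof -
      have "(\<Sum>w\<in>C. (\<mu>(v := t)) w *\<^sub>R w) = (\<Sum>w\<in>C. \<mu> w *\<^sub>R w)"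
        by (rule sum.cong) (use \<open>v \<notin> C\<close> in auto)
      then show ?thesis using \<open>v \<notin> C\<close> finite_sign_chain[OF C(1)] by simp
    qed
    finally show ?thesis
      using chain t C(2) conf conforms_refl unfolding v_def[symmetric]
      by (intro exI[of _ "insert v C"] exI[of _ "\<mu>(v := t)"]) auto
  qed
qed

text \<open>The functional exposing the face is a positive combination of a chain, so it reaches the
  weighted sum of the heights exactly where every member is tight. Since \<open>chain_face C\<close>
  is nonempty, this sum is attained and is the maximum.\<close>

lemma face_of_perm_B_is_chain_face:
  fixes F :: "(real ^ 'n::finite) set"
  assumes "F face_of perm_B" "F \<noteq> {}"
  shows "\<exists>C\<in>sign_chains. F = chain_face C"
proof -
  have "F exposed_face_of perm_B"
    using assms(1) exposed_face_of_polyhedron polytope_imp_polyhedron polytope_perm_B by blast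
  then obtain c b where cb: "perm_B \<subseteq> {x. c \<bullet> x \<le> b}" "F = perm_B \<inter> {x. c \<bullet> x = b}"
    unfolding exposed_face_of_def by blast
  obtain C \<mu> where C: "C \<in> sign_chains" "\<And>v. v \<in> C \<Longrightarrow> \<mu> v > 0" "c = (\<Sum>v\<in>C. \<mu> v *\<^sub>R v)"
    using positive_sum_of_sign_chain[of c] by blast
  have fin: "finite C" using C(1) by (rule finite_sign_chain)
  have cx: "c \<bullet> x = (\<Sum>v\<in>C. \<mu> v * (v \<bullet> x))" for x
    by (simp add: C(3) inner_sum_left)
  have le: "\<mu> v * (v \<bullet> x) \<le> \<mu> v * height v" if "v \<in> C" "x \<in> perm_B" for v x
    using inner_perm_B_le_height[OF _ that(2)] C(1) C(2)[OF that(1)] that(1)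
    unfolding sign_chains_def by (intro mult_left_mono) auto
  have max: "c \<bullet> x = (\<Sum>v\<in>C. \<mu> v * height v) \<longleftrightarrow> x \<in> chain_face C" if "x \<in> perm_B" for x
  proof -
    have "(\<Sum>v\<in>C. \<mu> v * height v - \<mu> v * (v \<bullet> x)) = 0 \<longleftrightarrow>
        (\<forall>v\<in>C. \<mu> v * height v - \<mu> v * (v \<bullet> x) = 0)"
      by (rule sum_nonneg_eq_0_iff) (use le that fin in auto)
    moreover have "\<mu> v * height v - \<mu> v * (v \<bullet> x) = 0 \<longleftrightarrow> v \<bullet> x = height v" if "v \<in> C" for v
      using C(2)[OF that] by auto
    ultimately show ?thesis
      using that unfolding sum_subtractf cx chain_face_def by auto
  qed
  obtain y where y: "y \<in> chain_face C" "y \<in> perm_B"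
    using chain_face_nonempty[OF C(1)] unfolding chain_face_def by blast
  obtain x where x: "x \<in> perm_B" "c \<bullet> x = b" using assms(2) cb(2) by blast
  have "b \<le> (\<Sum>v\<in>C. \<mu> v * height v)"
    unfolding x(2)[symmetric] cx by (rule sum_mono) (use le x(1) in blast)
  moreover have "(\<Sum>v\<in>C. \<mu> v * height v) \<le> b" using max[OF y(2)] y cb(1) by auto
  ultimately have "F = chain_face C"
    using max cb(2) unfolding chain_face_def by force
  then show ?thesis using C(1) by blast
qed

theorem bij_betw_chain_face:
  "bij_betw chain_face sign_chains {F. F face_of (perm_B :: (real ^ 'n::finite) set) \<and> F \<noteq> {}}"
proof (rule bij_betw_imageI)
  show "inj_on chain_face (sign_chains :: (real ^ 'n) set set)"
    using chain_face_subset_iff by (intro inj_onI) blast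
  show "chain_face ` sign_chains = {F. F face_of (perm_B :: (real ^ 'n) set) \<and> F \<noteq> {}}"
  proof
    show "chain_face ` sign_chains \<subseteq> {F. F face_of (perm_B :: (real ^ 'n) set) \<and> F \<noteq> {}}"
    proof clarify
      fix C :: "(real ^ 'n) set" assume C: "C \<in> sign_chains"
      then have "C \<subseteq> sign_vectors" by (simp add: sign_chains_def)
      then show "chain_face C face_of perm_B \<and> chain_face C \<noteq> {}"
        using chain_face_face_of chain_face_nonempty[OF C] by simp
    qed
    show "{F. F face_of (perm_B :: (real ^ 'n) set) \<and> F \<noteq> {}} \<subseteq> chain_face ` sign_chains"
      using face_of_perm_B_is_chain_face by blast
  qed
qed

section \<open>Existence of a dual, and the boundary complex of any dual\<close>

lemma ex_signed_perm:
  "\<exists>p. \<forall>s :: 'n::finite \<Rightarrow> real. (\<forall>i. s i \<in> {1, -1}) \<longrightarrow> signed_perm p s"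
proof -
  obtain p :: "'n \<Rightarrow> nat" where "bij_betw p UNIV {1..CARD('n)}"
    using bij_betw_inv_into ex_bij_betw_nat_finite_1[of "UNIV :: 'n set"] by auto
  then show ?thesis unfolding signed_perm_def by blast
qed

lemma zero_in_perm_B: "0 \<in> (perm_B :: (real ^ 'n::finite) set)"
proof -
  obtain p where p: "\<And>s :: 'n \<Rightarrow> real. (\<forall>i. s i \<in> {1, -1}) \<Longrightarrow> signed_perm p s"
    using ex_signed_perm by blast
  let ?x = "signed_perm_point p (\<lambda>_. 1)" and ?y = "signed_perm_point p (\<lambda>_. - 1)"
  have "?x \<in> perm_B" "?y \<in> perm_B" by (intro signed_perm_point_in_perm_B p, simp)+
  then have "(1/2) *\<^sub>R ?x + (1/2) *\<^sub>R ?y \<in> perm_B"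
    by (intro convexD[OF polytope_imp_convex[OF polytope_perm_B]]) auto
  moreover have "(1/2) *\<^sub>R ?x + (1/2) *\<^sub>R ?y = 0"
    by (simp add: signed_perm_point_def vec_eq_iff)
  ultimately show ?thesis by simp
qed

text \<open>Pairing \<open>y\<close> with a vertex whose signs match those of \<open>y\<close> gives
  at least the sum of the absolute values of its coordinates, because every \<open>p i\<close> is at
  least 1. So the polar lies in the unit ball.\<close>

lemma bounded_polar_perm_B: "bounded (polar (perm_B :: (real ^ 'n::finite) set))"
proof (rule boundedI)
  fix y :: "real ^ 'n" assume y: "y \<in> polar perm_B"
  obtain p where p: "\<And>s :: 'n \<Rightarrow> real. (\<forall>i. s i \<in> {1, -1}) \<Longrightarrow> signed_perm p s"
    using ex_signed_perm by blast
  define s where "s i = (if y $ i \<ge> 0 then 1 else - 1 :: real)" for i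
  have s: "signed_perm p s" by (rule p) (simp add: s_def)
  have "norm y \<le> (\<Sum>i\<in>UNIV. \<bar>y $ i\<bar>)" by (rule norm_le_l1_cart)
  also have "\<dots> \<le> (\<Sum>i\<in>UNIV. s i * real (p i) * y $ i)"
  proof (rule sum_mono)
    fix i
    have "1 * \<bar>y $ i\<bar> \<le> real (p i) * \<bar>y $ i\<bar>"
      using signed_perm_range(1)[OF s, of i] by (intro mult_right_mono) auto
    then show "\<bar>y $ i\<bar> \<le> s i * real (p i) * y $ i"
      by (auto simp: s_def abs_if)
  qed
  also have "\<dots> = signed_perm_point p s \<bullet> y"
    by (simp add: signed_perm_point_def inner_vec_def)
  also have "\<dots> \<le> 1"
    using y signed_perm_point_in_perm_B[OF s] unfolding polar_def by blast
  finally show "norm y \<le> 1" .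
qed

text \<open>The order-reversing bijection sends the empty face to \<open>Q\<close>, so nonempty
  faces of \<open>perm_B\<close> match faces of \<open>Q\<close> other than \<open>Q\<close>.
  Composed with \<open>chain_face\<close>, which also reverses order, it preserves order and meets
  the criterion for simplicial polytopes.\<close>

lemma dual_perm_B_boundary_complex:
  fixes Q :: "'b::euclidean_space set"
  assumes "dual_polytope (perm_B :: (real ^ 'n::finite) set) Q"
  shows "simplicial_polytope Q \<and>
    complex_iso (sign_chains :: (real ^ 'n) set set) (boundary_complex Q)"
proof -
  let ?P = "perm_B :: (real ^ 'n) set"
  obtain \<phi> where Q: "polytope Q"
    and bij: "bij_betw \<phi> {F. F face_of ?P} {G. G face_of Q}"
    and anti: "\<And>F F'. F face_of ?P \<Longrightarrow> F' face_of ?P \<Longrightarrow> F \<subseteq> F' \<longleftrightarrow> \<phi> F' \<subseteq> \<phi> F"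
    using assms unfolding dual_polytope_def by blast
  have "Q \<in> \<phi> ` {F. F face_of ?P}"
    unfolding bij_betw_imp_surj_on[OF bij] using Q polytope_imp_convex face_of_refl by blast
  then obtain F where F: "F face_of ?P" "Q = \<phi> F" by blast
  moreover have "\<phi> {} face_of Q" using bij_betw_apply[OF bij, of "{}"] by simp
  ultimately have "\<phi> {} = Q"
    using anti[OF empty_face_of F(1)] face_of_imp_subset by blast
  have "bij_betw \<phi> {{}} {Q}" using \<open>\<phi> {} = Q\<close> by (simp add: bij_betw_def)
  then have "bij_betw \<phi> ({F. F face_of ?P} - {{}}) ({G. G face_of Q} - {Q})"
    by (rule bij_betw_DiffI[OF bij]) (simp_all add: face_of_refl Q polytope_imp_convex)
  then have "bij_betw \<phi> {F. F face_of ?P \<and> F \<noteq> {}} {G. G face_of Q \<and> G \<noteq> Q}"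
    by (simp add: set_diff_eq)
  then have "bij_betw (\<phi> \<circ> chain_face) (sign_chains :: (real ^ 'n) set set)
      {G. G face_of Q \<and> G \<noteq> Q}"
    using bij_betw_chain_face bij_betw_trans by blast
  then show ?thesis
  proof (rule simplicial_polytope_if_face_poset_iso[OF Q, rotated 2])
    fix \<sigma> \<tau> :: "(real ^ 'n) set" assume *: "\<sigma> \<in> sign_chains"
    show "\<tau> \<subseteq> \<sigma> \<Longrightarrow> \<tau> \<in> sign_chains"
      using * unfolding sign_chains_def chain_def by blast
    assume \<tau>: "\<tau> \<in> sign_chains"
    have "chain_face \<sigma> face_of ?P" "chain_face \<tau> face_of ?P"
      using * \<tau> chain_face_face_of unfolding sign_chains_def by blast+
    then show "\<sigma> \<subseteq> \<tau> \<longleftrightarrow> (\<phi> \<circ> chain_face) \<sigma> \<subseteq> (\<phi> \<circ> chain_face) \<tau>"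
      using anti chain_face_subset_iff[OF * \<tau>] by simp
  next
    have "{} \<in> (sign_chains :: (real ^ 'n) set set)"
      by (simp add: sign_chains_def chain_def)
    then show "(sign_chains :: (real ^ 'n) set set) \<noteq> {}" by blast
  qed
qed

lemma ex_dual_perm_B: "\<exists>Q :: (real ^ 'n::finite) set. dual_polytope (perm_B :: (real ^ 'n) set) Q"
  using dual_polytope_polar[OF polytope_perm_B zero_in_perm_B bounded_polar_perm_B] by blast

section \<open>Tchebyshev triangulations\<close>

text \<open>What the subdivision argument uses of the suspension: vertices carry distinct labels in
  a partial order, and labels within a face are comparable. A chain of labels need not be a face,
  which leaves room for the two apexes that are not joined.\<close>

locale ranked_complex =
  fixes K :: "'v set set" and \<mu> :: "'v \<Rightarrow> 'a::order"
  assumes finite_vertices: "finite (\<Union>K)"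
    and subset_closed: "\<sigma> \<in> K \<Longrightarrow> \<tau> \<subseteq> \<sigma> \<Longrightarrow> \<tau> \<in> K"
    and chain: "\<sigma> \<in> K \<Longrightarrow> x \<in> \<sigma> \<Longrightarrow> y \<in> \<sigma> \<Longrightarrow> \<mu> x \<le> \<mu> y \<or> \<mu> y \<le> \<mu> x"
    and inj: "inj_on \<mu> (\<Union>K)"
begin

text \<open>An edge \<open>e\<close> stands for the interval spanned by its endpoints; \<open>nested d e\<close> says that the interval of
  \<open>d\<close> lies in that of \<open>e\<close>.\<close>

definition between :: "'v set \<Rightarrow> 'v \<Rightarrow> bool" where
  "between e x \<longleftrightarrow> (\<exists>a\<in>e. \<mu> a \<le> \<mu> x) \<and> (\<exists>b\<in>e. \<mu> x \<le> \<mu> b)"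

definition nested :: "'v set \<Rightarrow> 'v set \<Rightarrow> bool" where
  "nested d e \<longleftrightarrow> (\<forall>x\<in>d. between e x)"

text \<open>The invariant of the order of subdivision: an edge is in the set only together with all
  edges of larger interval.\<close>

definition up_closed :: "'v set set \<Rightarrow> bool" where
  "up_closed A \<longleftrightarrow> (\<forall>d\<in>A. \<forall>e\<in>edges K. nested d e \<longrightarrow> e \<in> A)"

text \<open>\<open>C\<close> collects the original vertices of a face and \<open>E\<close> the edges
  whose midpoints it contains. For \<open>A = {}\<close> these are the faces of \<open>K\<close>; if
  \<open>A\<close> consists of all edges, \<open>C\<close> has at most one vertex and the faces
  become chains of intervals.\<close>

definition subdivided_face :: "'v set set \<Rightarrow> 'v set \<Rightarrow> 'v set set \<Rightarrow> bool" where
  "subdivided_face A C E \<longleftrightarrow> E \<subseteq> A \<and> C \<union> \<Union>E \<in> K \<and> (\<forall>e\<in>E. nested C e) \<and>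
     (\<forall>d\<in>E. \<forall>e\<in>E. nested d e \<or> nested e d) \<and> (\<forall>e\<in>A. \<not> e \<subseteq> C)"

text \<open>This is the complex obtained from \<open>K\<close> after the edges in \<open>A\<close> have been subdivided, provided
  that larger intervals come before smaller ones.\<close>

definition subdivided :: "'v set set \<Rightarrow> ('v + 'v set) set set" where
  "subdivided A = {\<sigma>. subdivided_face A (Inl -` \<sigma>) (Inr -` \<sigma>)}"

lemma between_trans: "between d x \<Longrightarrow> nested d e \<Longrightarrow> between e x"
  unfolding between_def nested_def by (meson order_trans)

lemma nested_refl: "nested e e"
  unfolding between_def nested_def by blast

lemma nested_mono: "nested d e \<Longrightarrow> c \<subseteq> d \<Longrightarrow> nested c e"
  unfolding nested_def by blast

lemma edge_cases:
  assumes "e \<in> edges K"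
  obtains a b where "e = {a, b}" "\<mu> a < \<mu> b" "a \<in> \<Union>K" "b \<in> \<Union>K"
proof -
  have e: "e \<in> K" "card e = 2" using assms unfolding edges_def by auto
  then obtain a b where ab: "e = {a, b}" "a \<noteq> b" by (meson card_2_iff)
  then have m: "a \<in> \<Union>K" "b \<in> \<Union>K" using e by auto
  then have "\<mu> a \<noteq> \<mu> b" using ab inj by (meson inj_onD)
  moreover have "\<mu> a \<le> \<mu> b \<or> \<mu> b \<le> \<mu> a" using chain e ab by blast
  ultimately consider "\<mu> a < \<mu> b" | "\<mu> b < \<mu> a" by fastforce
  then show ?thesis
  proof cases
    case 1
    then show ?thesis using that ab m by blast
  next
    case 2
    then show ?thesis using that[of b a] ab m by blast
  qed
qed

lemma between_pair: "\<mu> a \<le> \<mu> b \<Longrightarrow> between {a, b} x \<longleftrightarrow> \<mu> a \<le> \<mu> x \<and> \<mu> x \<le> \<mu> b"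
  unfolding between_def by (auto intro: order_trans)

lemma nested_antisym:
  assumes "d \<in> edges K" "e \<in> edges K" "nested d e" "nested e d"
  shows "d = e"
proof -
  obtain a b where ab: "d = {a, b}" "\<mu> a < \<mu> b" "a \<in> \<Union>K" "b \<in> \<Union>K"
    by (rule edge_cases[OF assms(1)])
  obtain a' b' where ab': "e = {a', b'}" "\<mu> a' < \<mu> b'" "a' \<in> \<Union>K" "b' \<in> \<Union>K"
    by (rule edge_cases[OF assms(2)])
  have "\<mu> a = \<mu> a'" "\<mu> b = \<mu> b'"
    using assms(3,4) ab(2) ab'(2) unfolding ab(1) ab'(1) nested_def
    by (auto simp: between_pair intro: antisym)
  then have "a = a'" "b = b'"
    using inj_onD[OF inj] ab(3,4) ab'(3,4) by simp_all
  then show ?thesis using ab(1) ab'(1) by simp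
qed

lemma finite_edges: "finite (edges K)"
proof (rule finite_subset)
  show "edges K \<subseteq> Pow (\<Union>K)" unfolding edges_def by blast
qed (simp add: finite_vertices)

lemma subdivided_face_mono:
  assumes "subdivided_face A C E" "C' \<subseteq> C" "E' \<subseteq> E"
  shows "subdivided_face A C' E'"
proof -
  have "C' \<union> \<Union>E' \<in> K"
    by (rule subset_closed[of "C \<union> \<Union>E"])
      (use assms in \<open>auto simp: subdivided_face_def intro: Un_mono\<close>)
  then show ?thesis
    using assms nested_mono unfolding subdivided_face_def by (meson subset_trans subsetD)
qed

lemma subdivided_subset_closed:
  assumes "\<sigma> \<in> subdivided A" "\<tau> \<subseteq> \<sigma>"
  shows "\<tau> \<in> subdivided A"
  using assms subdivided_face_mono vimage_mono unfolding subdivided_def mem_Collect_eq by metis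

lemma subdivided_face_empty: "subdivided_face {} C E \<longleftrightarrow> E = {} \<and> C \<in> K"
  unfolding subdivided_face_def by (cases "E = {}") simp_all

lemma subdivided_empty: "subdivided {} = (\<lambda>\<sigma>. Inl ` \<sigma>) ` K"
proof
  show "subdivided {} \<subseteq> (\<lambda>\<sigma>. Inl ` \<sigma>) ` K"
  proof
    fix \<sigma> assume "\<sigma> \<in> subdivided {}"
    then have E: "Inr -` \<sigma> = {}" and "Inl -` \<sigma> \<in> K"
      unfolding subdivided_def by (simp_all add: subdivided_face_empty)
    have "y \<in> Inl ` (Inl -` \<sigma>)" if "y \<in> \<sigma>" for y
      using that E by (cases y) auto
    then have "\<sigma> = Inl ` (Inl -` \<sigma>)" by auto
    then show "\<sigma> \<in> (\<lambda>\<sigma>. Inl ` \<sigma>) ` K" using \<open>Inl -` \<sigma> \<in> K\<close> by (rule image_eqI)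
  qed
  have "Inl -` (Inl ` \<sigma> :: ('v + 'v set) set) = \<sigma>" "Inr -` (Inl ` \<sigma> :: ('v + 'v set) set) = {}"
    for \<sigma> by auto
  then show "(\<lambda>\<sigma>. Inl ` \<sigma>) ` K \<subseteq> subdivided {}"
    unfolding subdivided_def image_subset_iff by (simp add: subdivided_face_empty)
qed

section \<open>The effect of a single stellar subdivision\<close>

text \<open>The delicate faces are those through the new midpoint: their other original vertices
  must lie in the interval of \<open>e\<close>. This is where larger intervals having been
  subdivided before \<open>e\<close> is used.\<close>

lemma stellar_subdivision_subdivided_subset:
  assumes e: "e \<in> edges K" and up: "up_closed (insert e A)"
    and A: "A \<subseteq> edges K" "e \<notin> A"
  shows "stellar_subdivision (subdivided A) (Inl ` e) (Inr e) \<subseteq> subdivided (insert e A)"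
proof
  fix \<sigma> assume "\<sigma> \<in> stellar_subdivision (subdivided A) (Inl ` e) (Inr e)"
  \<comment> \<open>The path face may be smaller than an edge of the path; the full edge is treated
    instead, and closure under subsets returns to \<sigma>.\<close>
  then consider "\<sigma> \<in> subdivided A" "\<not> Inl ` e \<subseteq> \<sigma>"
    | x \<tau> where "x \<in> e" "\<tau> \<in> link (subdivided A) (Inl ` e)" "\<sigma> \<subseteq> {Inl x, Inr e} \<union> \<tau>"
    unfolding stellar_subdivision_def path_faces_def by blast
  then show "\<sigma> \<in> subdivided (insert e A)"
  proof cases
    case 1
    then show ?thesis
      unfolding subdivided_def subdivided_face_def image_subset_iff_subset_vimage by simp blast
  next
    case 2
    define C E where "C = Inl -` \<tau>" and "E = Inr -` \<tau>"
    have "Inl -` (Inl ` e \<union> \<tau>) = e \<union> C" "Inr -` (Inl ` e \<union> \<tau>) = E"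
      unfolding C_def E_def by auto
    moreover have "Inl ` e \<union> \<tau> \<in> subdivided A" and disj: "Inl ` e \<inter> \<tau> = {}"
      using 2(2) unfolding link_def by auto
    ultimately have "subdivided_face A (e \<union> C) E" unfolding subdivided_def by simp
    then have EA: "E \<subseteq> A" and face: "e \<union> C \<union> \<Union>E \<in> K"
      and nest: "\<And>d. d \<in> E \<Longrightarrow> nested (e \<union> C) d"
      and pair: "\<And>c d. c \<in> E \<Longrightarrow> d \<in> E \<Longrightarrow> nested c d \<or> nested d c"
      and no: "\<And>d. d \<in> A \<Longrightarrow> \<not> d \<subseteq> e \<union> C"
      unfolding subdivided_face_def by blast+
    have "e \<inter> C = {}" using disj unfolding C_def by auto
    obtain a b where ab: "e = {a, b}" "\<mu> a < \<mu> b" by (rule edge_cases[OF e])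
    \<comment> \<open>A vertex of \<open>C\<close> outside the interval of \<open>e\<close> would span, with the far endpoint of \<open>e\<close>,
      a larger edge, which has been subdivided already.\<close>
    have bad: False if c: "c \<in> C" and y: "y \<in> e" and w: "nested e {c, y}" for c y
    proof -
      have "c \<noteq> y" using c y \<open>e \<inter> C = {}\<close> by blast
      moreover have "{c, y} \<in> K" by (rule subset_closed[OF face]) (use c y in blast)
      ultimately have "{c, y} \<in> edges K" unfolding edges_def by simp
      then have "{c, y} \<in> insert e A" using up w unfolding up_closed_def by blast
      moreover have "{c, y} \<noteq> e" using c \<open>e \<inter> C = {}\<close> by blast
      ultimately have "{c, y} \<in> A" by blast
      then show False using no[of "{c, y}"] c y by blast
    qed
    have "nested C e"
    proof (unfold nested_def, rule ballI)
      fix c assume c: "c \<in> C"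
      have cmp: "\<mu> c \<le> \<mu> z \<or> \<mu> z \<le> \<mu> c" if "z \<in> e" for z
        using chain[OF face, of c z] c that by blast
      have "\<mu> a \<le> \<mu> c"
      proof (rule ccontr)
        assume "\<not> \<mu> a \<le> \<mu> c"
        then have "\<mu> c \<le> \<mu> a" using cmp ab(1) by blast
        then have "nested e {c, b}"
          using ab unfolding nested_def between_def by auto
        then show False using bad c ab(1) by blast
      qed
      moreover have "\<mu> c \<le> \<mu> b"
      proof (rule ccontr)
        assume "\<not> \<mu> c \<le> \<mu> b"
        then have "\<mu> b \<le> \<mu> c" using cmp ab(1) by blast
        then have "nested e {c, a}"
          using ab unfolding nested_def between_def by auto
        then show False using bad c ab(1) by blast
      qed
      ultimately show "between e c" unfolding between_def ab(1) by blast
    qed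
    then have "nested (insert x C) e"
      using nested_refl[of e] 2(1) unfolding nested_def by blast
    moreover have "nested (insert x C) d" if "d \<in> E" for d
      using nest[OF that] by (rule nested_mono) (use 2(1) in blast)
    moreover have "nested e d" if "d \<in> E" for d
      using nest[OF that] by (rule nested_mono) blast
    moreover have "insert x C \<union> \<Union>(insert e E) \<in> K"
      by (rule subset_closed[OF face]) (use 2(1) in blast)
    moreover have "\<not> d \<subseteq> insert x C" if "d \<in> insert e A" for d
    proof (cases "d = e")
      case True
      have "a \<noteq> b" using ab by blast
      then show ?thesis using True ab(1) \<open>e \<inter> C = {}\<close> by blast
    next
      case False
      then show ?thesis using no[of d] that 2(1) by blast
    qed
    ultimately have "subdivided_face (insert e A) (insert x C) (insert e E)"
      unfolding subdivided_face_def using EA pair nested_refl by auto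
    moreover have "Inl -` ({Inl x, Inr e} \<union> \<tau>) = insert x C"
      "Inr -` ({Inl x, Inr e} \<union> \<tau>) = insert e E"
      unfolding C_def E_def by auto
    ultimately have "{Inl x, Inr e} \<union> \<tau> \<in> subdivided (insert e A)"
      unfolding subdivided_def by simp
    then show ?thesis using 2(3) subdivided_subset_closed by blast
  qed
qed

text \<open>As \<open>A\<close> is closed upwards and misses \<open>e\<close>, no edge in
  \<open>A\<close> is nested in \<open>e\<close>. So in a face through the new midpoint all other
  midpoints belong to intervals containing \<open>e\<close>, and adding both endpoints of
  \<open>e\<close> creates no edge of \<open>A\<close> among the original vertices.\<close>

lemma subdivided_insert_subset_stellar_subdivision:
  assumes e: "e \<in> edges K" and up: "up_closed A" and A: "A \<subseteq> edges K" "e \<notin> A"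
  shows "subdivided (insert e A) \<subseteq> stellar_subdivision (subdivided A) (Inl ` e) (Inr e)"
proof
  fix \<sigma> assume \<sigma>: "\<sigma> \<in> subdivided (insert e A)"
  define C E where "C = Inl -` \<sigma>" and "E = Inr -` \<sigma>"
  have "subdivided_face (insert e A) C E"
    using \<sigma> unfolding subdivided_def C_def E_def by simp
  then have EA: "E \<subseteq> insert e A" and face: "C \<union> \<Union>E \<in> K"
    and nest: "\<And>d. d \<in> E \<Longrightarrow> nested C d"
    and pair: "\<And>c d. c \<in> E \<Longrightarrow> d \<in> E \<Longrightarrow> nested c d \<or> nested d c"
    and no: "\<forall>d \<in> insert e A. \<not> d \<subseteq> C"
    unfolding subdivided_face_def by blast+
  have not_nested: "\<not> nested d e" if "d \<in> A" for d
    using up[unfolded up_closed_def, rule_format, OF that e] A(2) by argo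
  show "\<sigma> \<in> stellar_subdivision (subdivided A) (Inl ` e) (Inr e)"
  proof (cases "e \<in> E")
    case False
    then have "E \<subseteq> A" using EA by blast
    then have "subdivided_face A C E"
      using face nest pair no unfolding subdivided_face_def by simp
    then have "\<sigma> \<in> subdivided A" unfolding subdivided_def C_def E_def by simp
    moreover have "\<not> Inl ` e \<subseteq> \<sigma>" 
      using no unfolding C_def by (simp add: image_subset_iff_subset_vimage)
    ultimately show ?thesis unfolding stellar_subdivision_def by blast
  next
    case True
    define \<tau> where "\<tau> = \<sigma> - Inl ` e - {Inr e}"
    have CE: "Inl -` (Inl ` e \<union> \<tau>) = e \<union> C" "Inr -` (Inl ` e \<union> \<tau>) = E - {e}"
      unfolding \<tau>_def C_def E_def by auto
    have "nested (e \<union> C) d" if d: "d \<in> E - {e}" for d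
    proof -
      have "d \<in> A" using EA d by blast
      then have "nested e d" using pair[OF True, of d] not_nested d by blast
      then show ?thesis using nest[of d] d unfolding nested_def by blast
    qed
    moreover have "e \<union> C \<union> \<Union>(E - {e}) \<in> K"
      by (rule subset_closed[OF face]) (use True in blast)
    moreover have "\<not> d \<subseteq> e \<union> C" if "d \<in> A" for d
    proof
      assume "d \<subseteq> e \<union> C"
      then have "nested d e" using nest[OF True] nested_refl[of e] unfolding nested_def by blast
      then show False using not_nested that by blast
    qed
    ultimately have "subdivided_face A (e \<union> C) (E - {e})"
      unfolding subdivided_face_def using EA pair by auto
    then have "Inl ` e \<union> \<tau> \<in> subdivided A"
      unfolding subdivided_def using CE by simp
    moreover from this have "\<tau> \<in> subdivided A"
      using subdivided_subset_closed by blast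
    ultimately have link: "\<tau> \<in> link (subdivided A) (Inl ` e)"
      unfolding link_def \<tau>_def by blast
    obtain a b where ab: "e = {a, b}" by (rule edge_cases[OF e])
    \<comment> \<open>The edge \<open>e\<close> counts as subdivided in \<sigma>, so at most one of
      its endpoints is present, and the part outside \<tau> is a face of the path.\<close>
    have "Inl a \<notin> \<sigma> \<or> Inl b \<notin> \<sigma>" using no unfolding C_def ab by simp
    then have "\<exists>x\<in>{a, b}. \<sigma> \<inter> (Inl ` {a, b} \<union> {Inr e}) \<subseteq> {Inl x, Inr e}"
      by blast
    then have "\<exists>x\<in>e. \<sigma> \<inter> (Inl ` e \<union> {Inr e}) \<subseteq> {Inl x, Inr e}"
      unfolding ab .
    then have "\<sigma> \<inter> (Inl ` e \<union> {Inr e}) \<in> path_faces (Inl ` e) (Inr e)"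
      unfolding path_faces_def by blast
    moreover have "\<sigma> = \<sigma> \<inter> (Inl ` e \<union> {Inr e}) \<union> \<tau>" unfolding \<tau>_def by blast
    ultimately show ?thesis
      unfolding stellar_subdivision_def using link by blast
  qed
qed

section \<open>Subdividing all edges, larger intervals first\<close>

lemma subdivide_edges_eq_subdivided:
  assumes "distinct es" "set es \<subseteq> edges K" "up_closed (set es)"
    "sorted_wrt (\<lambda>d e. \<not> nested d e) es"
  shows "subdivide_edges K es = subdivided (set es)"
  using assms
proof (induction es rule: rev_induct)
  case Nil
  then show ?case by (simp add: subdivide_edges_def subdivided_empty)
next
  case (snoc e es)
  have ne: "\<not> nested d e" if "d \<in> set es" for d
    using snoc.prems(4) that by (simp add: sorted_wrt_append)
  have up: "up_closed (set es)"
    unfolding up_closed_def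
  proof (intro ballI impI)
    fix d d' assume d: "d \<in> set es" "d' \<in> edges K" "nested d d'"
    have "d \<in> set (es @ [e])" using d(1) by simp
    then have "d' \<in> set (es @ [e])"
      by (rule snoc.prems(3)[unfolded up_closed_def, rule_format, OF _ d(2,3)])
    \<comment> \<open>The last edge \<open>e\<close> contains no earlier interval, so a larger
      interval \<open>d'\<close> was already in the prefix.\<close>
    then show "d' \<in> set es" using ne[OF d(1)] d(3) by auto
  qed
  then have "subdivide_edges K es = subdivided (set es)"
    using snoc.prems by (intro snoc.IH) (auto simp: sorted_wrt_append)
  then have "subdivide_edges K (es @ [e]) =
      stellar_subdivision (subdivided (set es)) (Inl ` e) (Inr e)"
    by (simp add: subdivide_edges_def)
  also have "\<dots> = subdivided (insert e (set es))"
    using stellar_subdivision_subdivided_subset[of e "set es"]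
      subdivided_insert_subset_stellar_subdivision[of e "set es"] snoc.prems up
    by simp
  finally show ?case by simp
qed

theorem tchebyshev_triangulation_subdivided:
  "tchebyshev_triangulation K (subdivided (edges K))"
proof -
  \<comment> \<open>The size of an interval is measured by the vertices of \<open>K\<close> in it;
    the minus sign makes sorting put large intervals first.\<close>
  define r where "r e = - int (card {x \<in> \<Union>K. between e x})" for e
  obtain xs where xs: "set xs = edges K \<and> distinct xs"
    by (rule exE[OF finite_distinct_list[OF finite_edges]])
  define es where "es = sort_key r xs"
  have es: "set es = edges K" "distinct es" "sorted (map r es)"
    unfolding es_def using xs by simp_all
  have not_nested: "\<not> nested d e"
    if de: "d \<in> edges K" "e \<in> edges K" "d \<noteq> e" and r: "r d \<le> r e" for d e
  proof
    assume w: "nested d e"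
    let ?B = "\<lambda>e. {x \<in> \<Union>K. between e x}"
    have "?B d \<subseteq> ?B e" 
      using between_trans[OF _ w] by (simp add: Collect_mono_iff)
    moreover have "card (?B e) \<le> card (?B d)" using r unfolding r_def by simp
    moreover have "finite (?B e)" by (rule finite_subset[OF _ finite_vertices]) blast
    \<comment> \<open>Nested intervals with equally many vertices contain the same vertices, in
      particular the endpoints of \<open>e\<close>, so they would be nested both ways.\<close>
    ultimately have "?B d = ?B e" by (rule card_seteq[rotated])
    moreover have "e \<subseteq> ?B e"
      using de(2) nested_refl[of e] unfolding nested_def edges_def by blast
    ultimately have "nested e d" unfolding nested_def by blast
    then show False using nested_antisym[OF de(1,2) w] de(3) by blast
  qed
  have "sorted_wrt (\<lambda>d e. \<not> nested d e) es"
    unfolding sorted_wrt_iff_nth_less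
  proof (intro allI impI)
    fix i j assume ij: "i < j" "j < length es"
    then have "r (es ! i) \<le> r (es ! j)" "es ! i \<noteq> es ! j"
      using es(2) sorted_nth_mono[OF es(3), of i j] by (auto simp: nth_eq_iff_index_eq)
    moreover have "es ! i \<in> edges K" "es ! j \<in> edges K" using ij es(1) nth_mem by auto
    ultimately show "\<not> nested (es ! i) (es ! j)" using not_nested by blast
  qed
  then have "subdivide_edges K es = subdivided (edges K)"
    using subdivide_edges_eq_subdivided[OF es(2)] es(1) unfolding up_closed_def by simp
  then show ?thesis
    unfolding tchebyshev_triangulation_def using es(1,2) by metis
qed

section \<open>Faces of the full subdivision as chains of intervals\<close>

text \<open>The ends of the interval that a vertex stands for, so that one-point intervals and
  midpoints are compared by the same relation \<open>nested\<close>.\<close>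

definition vertex_support :: "'v + 'v set \<Rightarrow> 'v set" where
  "vertex_support X = (case X of Inl x \<Rightarrow> {x} | Inr e \<Rightarrow> e)"

lemma vertex_support_simps [simp]: "vertex_support (Inl x) = {x}" "vertex_support (Inr e) = e"
  by (simp_all add: vertex_support_def)

lemma nested_singleton_iff: "nested d {x} \<longleftrightarrow> (\<forall>y\<in>d. \<mu> y = \<mu> x)"
  unfolding nested_def between_def by (auto intro: antisym)

lemma subdivided_edges_vertices:
  assumes "\<sigma> \<in> subdivided (edges K)" "X \<in> \<sigma>"
  shows "X \<in> Inl ` \<Union>K \<union> Inr ` edges K"
proof -
  have face: "subdivided_face (edges K) (Inl -` \<sigma>) (Inr -` \<sigma>)"
    using assms(1) unfolding subdivided_def by simp
  show ?thesis
  proof (cases X)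
    case (Inl x)
    then have "x \<in> Inl -` \<sigma>" using assms(2) by simp
    then show ?thesis using face Inl unfolding subdivided_face_def by blast
  next
    case (Inr e)
    then have "e \<in> Inr -` \<sigma>" using assms(2) by simp
    then show ?thesis using face Inr unfolding subdivided_face_def by blast
  qed
qed

text \<open>With every edge subdivided, two distinct original vertices never share a face; the
  remaining pairs are nested by the definition of \<open>subdivided_face\<close>.\<close>

lemma subdivided_edges_nested:
  assumes \<sigma>: "\<sigma> \<in> subdivided (edges K)" and X: "X \<in> \<sigma>" and Y: "Y \<in> \<sigma>"
  shows "nested (vertex_support X) (vertex_support Y) \<or> nested (vertex_support Y) (vertex_support X)"
proof -
  define C E where "C = Inl -` \<sigma>" and "E = Inr -` \<sigma>"
  have face: "subdivided_face (edges K) C E"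
    using \<sigma> unfolding subdivided_def C_def E_def by simp
  have CE: "nested {x} e" if "x \<in> C" "e \<in> E" for x e
    using face that nested_mono[of C e "{x}"] unfolding subdivided_face_def by simp
  have eq: "x = y" if "x \<in> C" "y \<in> C" for x y
  proof (rule ccontr)
    assume "x \<noteq> y"
    moreover have "C \<union> \<Union>E \<in> K" using face unfolding subdivided_face_def by simp
    then have "{x, y} \<in> K" by (rule subset_closed) (use that in simp)
    ultimately have "{x, y} \<in> edges K" unfolding edges_def by simp
    have "\<forall>e\<in>edges K. \<not> e \<subseteq> C" using face unfolding subdivided_face_def by simp
    then have "\<not> {x, y} \<subseteq> C" using \<open>{x, y} \<in> edges K\<close> by (rule bspec)
    then show False using that by simp
  qed
  have CC: "nested {x} {y}" if "x \<in> C" "y \<in> C" for x y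
    unfolding eq[OF that] by (rule nested_refl)
  have EE: "nested d e \<or> nested e d" if "d \<in> E" "e \<in> E" for d e
    using face that unfolding subdivided_face_def by simp
  show ?thesis
    using X Y CC CE EE unfolding C_def E_def by (cases X; cases Y) simp_all
qed

text \<open>Distinct one-point intervals are not nested, so at most one original vertex occurs; a
  proper interval is not nested in a one-point one, so that vertex lies inside all
  intervals.\<close>

lemma subdivided_edgesI:
  assumes vert: "\<sigma> \<subseteq> Inl ` \<Union>K \<union> Inr ` edges K"
    and face: "(\<Union>X\<in>\<sigma>. vertex_support X) \<in> K"
    and nest: "\<And>X Y. X \<in> \<sigma> \<Longrightarrow> Y \<in> \<sigma> \<Longrightarrow>
      nested (vertex_support X) (vertex_support Y) \<or> nested (vertex_support Y) (vertex_support X)"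
  shows "\<sigma> \<in> subdivided (edges K)"
proof -
  define C E where "C = Inl -` \<sigma>" and "E = Inr -` \<sigma>"
  have C: "Inl x \<in> \<sigma>" if "x \<in> C" for x using that by (simp add: C_def)
  have E: "Inr e \<in> \<sigma>" if "e \<in> E" for e using that by (simp add: E_def)
  have CK: "x \<in> \<Union>K" if "x \<in> C" for x using C[OF that] vert by auto
  have EK: "e \<in> edges K" if "e \<in> E" for e using E[OF that] vert by auto
  have ne: "\<exists>a b. e = {a, b} \<and> \<mu> a < \<mu> b \<and> a \<in> \<Union>K \<and> b \<in> \<Union>K" if "e \<in> edges K" for e
    by (rule edge_cases[OF that]) (intro exI conjI)
  have CE: "between e x" if "x \<in> C" "e \<in> E" for x e
  proof -
    have "nested {x} e \<or> nested e {x}" using nest[OF C[OF that(1)] E[OF that(2)]] by simp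
    moreover have "\<not> nested e {x}"
      using ne[OF EK[OF that(2)]] by (auto simp: nested_singleton_iff)
    ultimately have "nested {x} e" by argo
    then show ?thesis by (simp add: nested_def)
  qed
  have CC: "x = y" if "x \<in> C" "y \<in> C" for x y
  proof -
    have "\<mu> x = \<mu> y"
      using nest[OF C[OF that(1)] C[OF that(2)]] by (auto simp: nested_singleton_iff)
    then show ?thesis using inj_onD[OF inj] CK that by simp
  qed
  have "C \<union> \<Union>E \<in> K"
  proof (rule subset_closed[OF face], rule subsetI)
    fix x assume "x \<in> C \<union> \<Union>E"
    then show "x \<in> (\<Union>X\<in>\<sigma>. vertex_support X)"
    proof
      assume "x \<in> C"
      then show ?thesis by (intro UN_I[OF C]) simp_all
    next
      assume "x \<in> \<Union>E"
      then obtain e where "e \<in> E" "x \<in> e" by (rule UnionE)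
      then show ?thesis by (intro UN_I[OF E]) simp_all
    qed
  qed
  moreover have "nested d e \<or> nested e d" if "d \<in> E" "e \<in> E" for d e
    using nest[OF E[OF that(1)] E[OF that(2)]] by simp
  moreover have "\<not> e \<subseteq> C" if e: "e \<in> edges K" for e
  proof
    assume "e \<subseteq> C"
    obtain a b where "e = {a, b}" "\<mu> a < \<mu> b" by (rule edge_cases[OF e])
    then show False using CC[of a b] \<open>e \<subseteq> C\<close> by simp
  qed
  ultimately have "subdivided_face (edges K) C E"
    using EK CE unfolding subdivided_face_def nested_def by (simp add: subset_iff)
  then show ?thesis unfolding subdivided_def C_def E_def by simp
qed

end

section \<open>Intervals and sign vectors\<close>

text \<open>The apexes take over the labels \<open>{}\<close> and \<open>N\<close> that were removed
  from the Boolean lattice, so the labels in a face of the suspension form a chain of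
  subsets.\<close>

definition subset_of_vertex :: "'c set \<Rightarrow> 'c set + bool \<Rightarrow> 'c set" where
  "subset_of_vertex N x = (case x of Inl A \<Rightarrow> A | Inr b \<Rightarrow> if b then N else {})"

definition vertex_of_subset :: "'c set \<Rightarrow> 'c set \<Rightarrow> 'c set + bool" where
  "vertex_of_subset N A = (if A = {} then Inr False else if A = N then Inr True else Inl A)"

abbreviation (input) boolean_suspension :: "'c set \<Rightarrow> ('c set + bool) set set" where
  "boolean_suspension N \<equiv> suspension (order_complex (Pow N - {{}, N}))"

lemma subset_of_vertex_of_subset [simp]: "subset_of_vertex N (vertex_of_subset N A) = A"
  by (simp add: subset_of_vertex_def vertex_of_subset_def)

lemma complex_join_iff: "\<sigma> \<in> complex_join K L \<longleftrightarrow> Inl -` \<sigma> \<in> K \<and> Inr -` \<sigma> \<in> L"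
proof
  have "Inl -` (a <+> b) = a" "Inr -` (a <+> b) = b" for a :: "'a set" and b :: "'b set"
    by auto
  then show "\<sigma> \<in> complex_join K L \<Longrightarrow> Inl -` \<sigma> \<in> K \<and> Inr -` \<sigma> \<in> L"
    unfolding complex_join_def by auto
  have "X \<in> \<sigma> \<longleftrightarrow> X \<in> Inl -` \<sigma> <+> Inr -` \<sigma>" for X
    by (cases X) auto
  then have "\<sigma> = Inl -` \<sigma> <+> Inr -` \<sigma>" by blast
  then show "Inl -` \<sigma> \<in> K \<and> Inr -` \<sigma> \<in> L \<Longrightarrow> \<sigma> \<in> complex_join K L"
    unfolding complex_join_def by blast
qed

text \<open>Everything is expressed through labels. Requiring that a vertex be recovered from its
  label excludes \<open>Inl {}\<close> and \<open>Inl N\<close>, which share their labels with the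
  apexes but are no vertices. The last condition says that the apexes do not occur together.\<close>

lemma boolean_suspension_iff:
  assumes "finite N" "N \<noteq> {}"
  shows "\<sigma> \<in> boolean_suspension N \<longleftrightarrow>
    (\<forall>x\<in>\<sigma>. subset_of_vertex N x \<subseteq> N \<and> vertex_of_subset N (subset_of_vertex N x) = x) \<and>
    (\<forall>x\<in>\<sigma>. \<forall>y\<in>\<sigma>. subset_of_vertex N x \<subseteq> subset_of_vertex N y \<or>
      subset_of_vertex N y \<subseteq> subset_of_vertex N x) \<and>
    \<not> {{}, N} \<subseteq> subset_of_vertex N ` \<sigma>"
proof -
  let ?m = "subset_of_vertex N"
  have L: "(\<forall>x\<in>\<sigma>. ?m x \<subseteq> N \<and> vertex_of_subset N (?m x) = x) \<longleftrightarrow> Inl -` \<sigma> \<subseteq> Pow N - {{}, N}"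
    (is "?V \<longleftrightarrow> ?W")
  proof
    assume V: ?V
    show ?W
    proof
      fix A assume "A \<in> Inl -` \<sigma>"
      then have "Inl A \<in> \<sigma>" by simp
      then show "A \<in> Pow N - {{}, N}"
        using V by (force simp: subset_of_vertex_def vertex_of_subset_def split: if_splits)
    qed
  next
    assume W: ?W
    show ?V
    proof
      fix x assume "x \<in> \<sigma>"
      then show "?m x \<subseteq> N \<and> vertex_of_subset N (?m x) = x"
      proof (cases x)
        case (Inl A)
        then have "A \<in> Pow N - {{}, N}" using W \<open>x \<in> \<sigma>\<close> by blast
        then show ?thesis using Inl by (simp add: subset_of_vertex_def vertex_of_subset_def)
      next
        case (Inr b)
        then show ?thesis
          using assms(2) by (cases b) (simp_all add: subset_of_vertex_def vertex_of_subset_def)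
      qed
    qed
  qed
  have fin: "finite (Inl -` \<sigma>)" if ?W
    by (rule finite_subset[OF that]) (simp add: assms(1))
  have chain: "(\<forall>x\<in>\<sigma>. \<forall>y\<in>\<sigma>. ?m x \<subseteq> ?m y \<or> ?m y \<subseteq> ?m x) \<longleftrightarrow>
      Complete_Partial_Order.chain (\<subseteq>) (Inl -` \<sigma>)" if W: ?W
  proof
    assume *: "\<forall>x\<in>\<sigma>. \<forall>y\<in>\<sigma>. ?m x \<subseteq> ?m y \<or> ?m y \<subseteq> ?m x"
    show "Complete_Partial_Order.chain (\<subseteq>) (Inl -` \<sigma>)"
    proof (rule chainI)
      fix A B assume "A \<in> Inl -` \<sigma>" "B \<in> Inl -` \<sigma>"
      then have "?m (Inl A) \<subseteq> ?m (Inl B) \<or> ?m (Inl B) \<subseteq> ?m (Inl A)" using * by simp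
      then show "A \<subseteq> B \<or> B \<subseteq> A" by (simp add: subset_of_vertex_def)
    qed
  next
    assume *: "Complete_Partial_Order.chain (\<subseteq>) (Inl -` \<sigma>)"
    have Inl: "A \<subseteq> N" if "Inl A \<in> \<sigma>" for A using W that by auto
    show "\<forall>x\<in>\<sigma>. \<forall>y\<in>\<sigma>. ?m x \<subseteq> ?m y \<or> ?m y \<subseteq> ?m x"
    proof (intro ballI)
      fix x y assume "x \<in> \<sigma>" "y \<in> \<sigma>"
      then show "?m x \<subseteq> ?m y \<or> ?m y \<subseteq> ?m x"
        using chainD[OF *] Inl by (cases x; cases y) (auto simp: subset_of_vertex_def)
    qed
  qed
  have apex: "Inr -` \<sigma> \<in> {{}, {False}, {True}} \<longleftrightarrow> \<not> {{}, N} \<subseteq> ?m ` \<sigma>" if W: ?W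
  proof -
    have "{} \<in> ?m ` \<sigma> \<longleftrightarrow> Inr False \<in> \<sigma>"
    proof
      assume "{} \<in> ?m ` \<sigma>"
      then obtain x where "x \<in> \<sigma>" "?m x = {}" by auto
      moreover from this have "vertex_of_subset N (?m x) = x" using W L by blast
      ultimately show "Inr False \<in> \<sigma>" by (simp add: vertex_of_subset_def)
    qed (force simp: subset_of_vertex_def image_iff)
    moreover have "N \<in> ?m ` \<sigma> \<longleftrightarrow> Inr True \<in> \<sigma>"
    proof
      assume "N \<in> ?m ` \<sigma>"
      then obtain x where "x \<in> \<sigma>" "?m x = N" by auto
      moreover from this have "vertex_of_subset N (?m x) = x" using W L by blast
      ultimately show "Inr True \<in> \<sigma>" using assms(2) by (simp add: vertex_of_subset_def)
    qed (force simp: subset_of_vertex_def image_iff)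
    moreover have "B \<in> {{}, {False}, {True}} \<longleftrightarrow> \<not> (False \<in> B \<and> True \<in> B)" for B
    proof -
      have "B \<in> Pow UNIV" by simp
      then have "B \<in> {{}, {False}, {True}, {False, True}}" unfolding UNIV_bool Pow_insert by auto
      then show ?thesis by auto
    qed
    ultimately show ?thesis by simp
  qed
  show ?thesis
    unfolding suspension_def complex_join_iff order_complex_def mem_Collect_eq L
  proof (cases ?W)
    case True
    then show "(?W \<and> finite (Inl -` \<sigma>) \<and> Complete_Partial_Order.chain (\<subseteq>) (Inl -` \<sigma>)) \<and>
        Inr -` \<sigma> \<in> {{}, {False}, {True}} \<longleftrightarrow> ?W \<and>
        (\<forall>x\<in>\<sigma>. \<forall>y\<in>\<sigma>. ?m x \<subseteq> ?m y \<or> ?m y \<subseteq> ?m x) \<and> \<not> {{}, N} \<subseteq> ?m ` \<sigma>"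
      unfolding chain[OF True] apex[OF True] using fin[OF True] by argo
  qed argo
qed

lemma ranked_complex_boolean_suspension:
  assumes "finite N" "N \<noteq> {}"
  shows "ranked_complex (boolean_suspension N) (subset_of_vertex N)"
proof
  note iff = boolean_suspension_iff[OF assms]
  have vert: "subset_of_vertex N x \<subseteq> N" "vertex_of_subset N (subset_of_vertex N x) = x"
    if "x \<in> \<Union>(boolean_suspension N)" for x
  proof -
    obtain \<sigma> where "\<sigma> \<in> boolean_suspension N" "x \<in> \<sigma>" using \<open>x \<in> _\<close> by (rule UnionE)
    then show "subset_of_vertex N x \<subseteq> N" "vertex_of_subset N (subset_of_vertex N x) = x"
      unfolding iff by simp_all
  qed
  show inj: "inj_on (subset_of_vertex N) (\<Union>(boolean_suspension N))"
    using vert(2) by (rule inj_on_inverseI)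
  show "finite (\<Union>(boolean_suspension N))"
  proof (rule finite_subset)
    show "\<Union>(boolean_suspension N) \<subseteq> vertex_of_subset N ` Pow N"
    proof
      fix x assume "x \<in> \<Union>(boolean_suspension N)"
      then show "x \<in> vertex_of_subset N ` Pow N"
        using vert[of x] by (intro image_eqI[of x _ "subset_of_vertex N x"]) simp_all
    qed
  qed (simp add: assms(1))
  fix \<sigma> assume \<sigma>: "\<sigma> \<in> boolean_suspension N"
  show "\<tau> \<in> boolean_suspension N" if "\<tau> \<subseteq> \<sigma>" for \<tau>
  proof -
    have "\<not> {{}, N} \<subseteq> subset_of_vertex N ` \<tau>"
      using \<sigma> image_mono[OF that, of "subset_of_vertex N"] unfolding iff by (meson subset_trans)
    then show ?thesis using \<sigma> subsetD[OF that] unfolding iff by simp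
  qed
  show "subset_of_vertex N x \<subseteq> subset_of_vertex N y \<or> subset_of_vertex N y \<subseteq> subset_of_vertex N x"
    if "x \<in> \<sigma>" "y \<in> \<sigma>" for x y
    using \<sigma> that unfolding iff by simp
qed

section \<open>Sign vectors as intervals, and the isomorphism\<close>

definition positive_coords :: "('n \<Rightarrow> 'c) \<Rightarrow> real ^ 'n \<Rightarrow> 'c set" where
  "positive_coords p v = p ` {i. v $ i = 1}"

definition nonneg_coords :: "('n \<Rightarrow> 'c) \<Rightarrow> real ^ 'n \<Rightarrow> 'c set" where
  "nonneg_coords p v = p ` {i. v $ i \<noteq> -1}"

lemma positive_subset_nonneg: "positive_coords p v \<subseteq> nonneg_coords p v"
  unfolding positive_coords_def nonneg_coords_def by (intro image_mono) auto

text \<open>Changing a zero to 1 adds an element to the lower end of the interval, and changing it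
  to -1 removes one from the upper end; conforming upwards means shrinking the interval.\<close>

lemma conforms_iff_coords:
  fixes v u :: "real ^ 'n::finite"
  assumes "inj p" "v \<in> sign_vectors" "u \<in> sign_vectors"
  shows "conforms v u \<longleftrightarrow>
    positive_coords p v \<subseteq> positive_coords p u \<and> nonneg_coords p u \<subseteq> nonneg_coords p v"
proof -
  have "(v $ i = 0 \<or> v $ i = u $ i) \<longleftrightarrow> (v $ i = 1 \<longrightarrow> u $ i = 1) \<and> (u $ i \<noteq> -1 \<longrightarrow> v $ i \<noteq> -1)" for i
  proof -
    have "v $ i \<in> {-1, 0, 1}" "u $ i \<in> {-1, 0, 1}"
      using assms(2,3) unfolding sign_vectors_def by blast+
    then show ?thesis by auto
  qed
  then show ?thesis
    unfolding conforms_def positive_coords_def nonneg_coords_def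
      inj_image_subset_iff[OF assms(1)] by auto
qed

text \<open>Take 1 on \<open>a\<close>, 0 on the rest of \<open>b\<close> and -1 outside
  \<open>b\<close>. The excluded interval would give the zero vector.\<close>

lemma sign_vector_with_coords:
  fixes p :: "'n::finite \<Rightarrow> 'c"
  assumes bij: "bij_betw p UNIV N" and ab: "a \<subseteq> b" "b \<subseteq> N" "\<not> (a = {} \<and> b = N)"
  obtains v where "v \<in> sign_vectors" "positive_coords p v = a" "nonneg_coords p v = b"
proof
  define v :: "real ^ 'n" where "v = (\<chi> i. if p i \<in> a then 1 else if p i \<in> b then 0 else -1)"
  have surj: "range p = N" using bij by (rule bij_betw_imp_surj_on)
  have "{i. v $ i = 1} = p -` a" "{i. v $ i \<noteq> -1} = p -` b"
    using ab(1) by (auto simp: v_def)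
  then show coords: "positive_coords p v = a" "nonneg_coords p v = b"
    using surj ab(1,2) unfolding positive_coords_def nonneg_coords_def
    by (simp_all add: image_vimage_eq Int_absorb2)
  have "v \<noteq> 0"
  proof
    assume "v = 0"
    then have "a = {}" "b = N"
      using coords surj unfolding positive_coords_def nonneg_coords_def by simp_all
    then show False using ab(3) by simp
  qed
  then show "v \<in> sign_vectors" by (simp add: sign_vectors_def v_def)
qed

theorem complex_iso_sign_chains_tchebyshev:
  fixes N :: "'c set"
  assumes N: "finite N" "N \<noteq> {}" and p: "bij_betw p (UNIV :: 'n::finite set) N"
  shows "\<exists>T. tchebyshev_triangulation (boolean_suspension N) T \<and>
    complex_iso (sign_chains :: (real ^ 'n) set set) T"
proof -
  define K where "K = boolean_suspension N"
  define \<mu> where "\<mu> = subset_of_vertex N"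
  define g where "g = vertex_of_subset N"
  interpret ranked_complex K \<mu>
    unfolding K_def \<mu>_def by (rule ranked_complex_boolean_suspension[OF N])
  have K: "\<sigma> \<in> K \<longleftrightarrow> (\<forall>x\<in>\<sigma>. \<mu> x \<subseteq> N \<and> g (\<mu> x) = x) \<and>
      (\<forall>x\<in>\<sigma>. \<forall>y\<in>\<sigma>. \<mu> x \<subseteq> \<mu> y \<or> \<mu> y \<subseteq> \<mu> x) \<and> \<not> {{}, N} \<subseteq> \<mu> ` \<sigma>" for \<sigma>
    unfolding K_def \<mu>_def g_def by (rule boolean_suspension_iff[OF N])
  have \<mu>_g [simp]: "\<mu> (g A) = A" for A by (simp add: \<mu>_def g_def)
  have g_\<mu>: "g (\<mu> x) = x" and \<mu>_sub: "\<mu> x \<subseteq> N" if "x \<in> \<Union>K" for x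
  proof -
    obtain \<sigma> where "\<sigma> \<in> K" "x \<in> \<sigma>" using \<open>x \<in> _\<close> by (rule UnionE)
    then show "g (\<mu> x) = x" "\<mu> x \<subseteq> N" unfolding K by simp_all
  qed
  have g_eq [simp]: "g A = g B \<longleftrightarrow> A = B" for A B by (metis \<mu>_g)
  define S where "S = (sign_vectors :: (real ^ 'n) set)"
  define P where "P v = positive_coords p v" for v :: "real ^ 'n"
  define M where "M v = nonneg_coords p v" for v :: "real ^ 'n"
  define s where "s v = {g (P v), g (M v)}" for v
  \<comment> \<open>Without zero coordinates the two ends coincide and an original vertex results;
    otherwise the image is the midpoint of the edge joining them.\<close>
  define f where "f v = (if P v = M v then Inl (g (P v)) else Inr (s v))" for v
  have surj: "range p = N" using p by (rule bij_betw_imp_surj_on)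
  have PM: "P v \<subseteq> M v" for v
    unfolding P_def M_def by (rule positive_subset_nonneg)
  have MN: "M v \<subseteq> N" for v
    unfolding M_def nonneg_coords_def surj[symmetric] by (rule image_mono) simp
  have s_f: "vertex_support (f v) = s v" for v by (simp add: f_def s_def)
  have conf: "conforms v u \<longleftrightarrow> nested (s u) (s v)" if "v \<in> S" "u \<in> S" for v u
  proof -
    have btw: "between (s v) x \<longleftrightarrow> P v \<subseteq> \<mu> x \<and> \<mu> x \<subseteq> M v" for x
      unfolding s_def by (subst between_pair) (simp_all add: PM)
    have "nested (s u) (s v) \<longleftrightarrow> P v \<subseteq> P u \<and> M u \<subseteq> M v"
      unfolding nested_def btw s_def[of u] using PM[of u] by auto
    then show ?thesis
      using conforms_iff_coords[OF bij_betw_imp_inj_on[OF p]] that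
      unfolding S_def P_def M_def by simp
  qed
  have f_inj: "inj_on f S"
  proof (rule inj_onI)
    fix v u assume vu: "v \<in> S" "u \<in> S" "f v = f u"
    then have "s v = s u" using s_f by metis
    then show "v = u"
      using conf[OF vu(1,2)] conf[OF vu(2,1)] nested_refl conforms_antisym by metis
  qed
  have not_full: "\<not> (P v = {} \<and> M v = N)" if "v \<in> S" for v
  proof
    assume *: "P v = {} \<and> M v = N"
    have "inj p" using p by (rule bij_betw_imp_inj_on)
    have "v $ i = 0" for i
    proof -
      have "v $ i \<noteq> 1" using * by (auto simp: P_def positive_coords_def)
      moreover have "p i \<in> p ` {i. v $ i \<noteq> -1}"
        using * surj by (auto simp: M_def nonneg_coords_def)
      then have "v $ i \<noteq> -1" using inj_image_mem_iff[OF \<open>inj p\<close>] by auto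
      ultimately show ?thesis using that unfolding S_def sign_vectors_def by blast
    qed
    then have "v = 0" by (simp add: vec_eq_iff)
    then show False using that unfolding S_def sign_vectors_def by simp
  qed
  \<comment> \<open>The ends of nested intervals form a single chain of subsets, so only the joint
    presence of both apexes has to be excluded.\<close>
  have support_face: "(\<Union>v\<in>\<sigma>. s v) \<in> K" if \<sigma>: "\<sigma> \<in> sign_chains" for \<sigma>
  proof -
    have mono: "P v \<subseteq> P u \<and> M u \<subseteq> M v \<or> P u \<subseteq> P v \<and> M v \<subseteq> M u" if "v \<in> \<sigma>" "u \<in> \<sigma>" for v u
    proof -
      have "v \<in> S" "u \<in> S" "conforms v u \<or> conforms u v"
        using \<sigma> that unfolding sign_chains_def S_def chain_def by auto
      then show ?thesis
        using conforms_iff_coords[OF bij_betw_imp_inj_on[OF p]] unfolding S_def P_def M_def by auto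
    qed
    have im: "\<exists>v\<in>\<sigma>. x = g (P v) \<or> x = g (M v)" if "x \<in> (\<Union>v\<in>\<sigma>. s v)" for x
      using that unfolding s_def by blast
    show ?thesis
      unfolding K
    proof (intro conjI ballI)
      fix x assume "x \<in> (\<Union>v\<in>\<sigma>. s v)"
      then obtain v where v: "v \<in> \<sigma>" "x = g (P v) \<or> x = g (M v)" using im by blast
      then show "\<mu> x \<subseteq> N" "g (\<mu> x) = x" using MN[of v] PM[of v] by auto
      fix y assume "y \<in> (\<Union>v\<in>\<sigma>. s v)"
      then obtain u where u: "u \<in> \<sigma>" "y = g (P u) \<or> y = g (M u)" using im by blast
      show "\<mu> x \<subseteq> \<mu> y \<or> \<mu> y \<subseteq> \<mu> x"
        using v(2) u(2) mono[OF v(1) u(1)] PM[of v] PM[of u] by (elim disjE) auto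
    next
      \<comment> \<open>If one of two nested intervals starts at \<open>{}\<close> and the other
        ends at \<open>N\<close>, the larger one is the full interval, which belongs to the zero
        vector.\<close>
      show "\<not> {{}, N} \<subseteq> \<mu> ` (\<Union>v\<in>\<sigma>. s v)"
      proof
        assume "{{}, N} \<subseteq> \<mu> ` (\<Union>v\<in>\<sigma>. s v)"
        then have "{} \<in> \<mu> ` (\<Union>v\<in>\<sigma>. s v)" "N \<in> \<mu> ` (\<Union>v\<in>\<sigma>. s v)" by simp_all
        then obtain v u where v: "v \<in> \<sigma>" "P v = {} \<or> M v = {}" and u: "u \<in> \<sigma>" "P u = N \<or> M u = N"
          unfolding s_def by auto
        have "P v = {}" using v(2) PM[of v] by auto
        moreover have "M u = N" using u(2) PM[of u] MN[of u] by auto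
        ultimately have "P v = {} \<and> M v = N \<or> P u = {} \<and> M u = N"
          using mono[OF v(1) u(1)] MN[of v] by auto
        moreover have "v \<in> S" "u \<in> S" using \<sigma> v(1) u(1) unfolding sign_chains_def S_def by auto
        ultimately show False using not_full by blast
      qed
    qed
  qed
  have "f ` \<sigma> \<in> subdivided (edges K)" if \<sigma>: "\<sigma> \<in> sign_chains" for \<sigma>
  proof (rule subdivided_edgesI)
    have \<sigma>S: "\<sigma> \<subseteq> S" using \<sigma> unfolding sign_chains_def S_def by blast
    show face: "(\<Union>X\<in>f ` \<sigma>. vertex_support X) \<in> K"
      using support_face[OF \<sigma>] by (simp add: s_f)
    show "f ` \<sigma> \<subseteq> Inl ` \<Union>K \<union> Inr ` edges K"
    proof (rule image_subsetI)
      fix v assume v: "v \<in> \<sigma>"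
      have "s v \<in> K" by (rule subset_closed[OF support_face[OF \<sigma>]]) (use v in blast)
      then show "f v \<in> Inl ` \<Union>K \<union> Inr ` edges K"
        by (auto simp: f_def edges_def s_def)
    qed
    fix X Y assume "X \<in> f ` \<sigma>" "Y \<in> f ` \<sigma>"
    then obtain v u where vu: "v \<in> \<sigma>" "X = f v" "u \<in> \<sigma>" "Y = f u" by blast
    then have "conforms v u \<or> conforms u v"
      using \<sigma> unfolding sign_chains_def chain_def by blast
    then show "nested (vertex_support X) (vertex_support Y) \<or>
        nested (vertex_support Y) (vertex_support X)"
      unfolding vu s_f using conf vu \<sigma>S by blast
  qed
  moreover have "\<exists>\<sigma>\<in>sign_chains. \<tau> = f ` \<sigma>" if \<tau>: "\<tau> \<in> subdivided (edges K)" for \<tau>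
  proof -
    define \<sigma> where "\<sigma> = {v \<in> S. f v \<in> \<tau>}"
    have ex: "\<exists>v\<in>S. P v = \<mu> a \<and> M v = \<mu> b"
      if "{a, b} \<in> K" "\<mu> a \<subseteq> \<mu> b" for a b
    proof -
      have "\<mu> b \<subseteq> N" "\<not> (\<mu> a = {} \<and> \<mu> b = N)"
        using that(1) unfolding K by auto
      then show ?thesis
        using sign_vector_with_coords[OF p that(2)] unfolding S_def P_def M_def by metis
    qed
    have cover: "X \<in> f ` S" if "X \<in> Inl ` \<Union>K \<union> Inr ` edges K" for X
      using that
    proof
      assume "X \<in> Inl ` \<Union>K"
      then obtain x where x: "x \<in> \<Union>K" "X = Inl x" by blast
      \<comment> \<open>An original vertex is treated as a degenerate edge, so that
        \<open>ex\<close> covers both kinds of vertices.\<close>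
      then have "{x, x} \<in> K" using subset_closed by auto
      then obtain v where "v \<in> S" "P v = \<mu> x" "M v = \<mu> x" using ex by blast
      then show ?thesis using x g_\<mu> by (intro image_eqI[of _ _ v]) (simp_all add: f_def)
    next
      assume "X \<in> Inr ` edges K"
      then obtain e where e: "e \<in> edges K" "X = Inr e" by blast
      obtain a b where ab: "e = {a, b}" "\<mu> a \<subset> \<mu> b" "a \<in> \<Union>K" "b \<in> \<Union>K"
        by (rule edge_cases[OF e(1)])
      have "{a, b} \<in> K" using e(1) ab(1) unfolding edges_def by simp
      then obtain v where "v \<in> S" "P v = \<mu> a" "M v = \<mu> b" using ex ab(2) by blast
      then show ?thesis
        using e(2) ab g_\<mu> by (intro image_eqI[of _ _ v]) (auto simp: f_def s_def)
    qed
    have "X \<in> f ` S" if "X \<in> \<tau>" for X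
      by (rule cover[OF subdivided_edges_vertices[OF \<tau> that]])
    then have "\<tau> = f ` \<sigma>" unfolding \<sigma>_def by auto
    moreover have "conforms v u \<or> conforms u v" if "v \<in> \<sigma>" "u \<in> \<sigma>" for v u
    proof -
      have vu: "v \<in> S" "u \<in> S" "f v \<in> \<tau>" "f u \<in> \<tau>" using that unfolding \<sigma>_def by auto
      show ?thesis
        using subdivided_edges_nested[OF \<tau> vu(3,4)] conf[OF vu(1,2)] conf[OF vu(2,1)]
        unfolding s_f by argo
    qed
    then have "\<sigma> \<in> sign_chains"
      unfolding sign_chains_def chain_def \<sigma>_def S_def by blast
    ultimately show ?thesis by blast
  qed
  ultimately have im: "(\<lambda>\<sigma>. f ` \<sigma>) ` sign_chains = subdivided (edges K)"
    by (intro subset_antisym image_subsetI subsetI) (simp_all add: image_iff)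
  have Union: "\<Union>sign_chains = S"
  proof
    show "\<Union>sign_chains \<subseteq> S" unfolding sign_chains_def S_def by blast
    have "{v} \<in> sign_chains" if "v \<in> S" for v
      using that conforms_refl unfolding sign_chains_def S_def chain_def by simp
    then show "S \<subseteq> \<Union>sign_chains" by (intro subsetI UnionI[of "{_}"]) simp_all
  qed
  have "f ` \<Union>sign_chains = \<Union>(subdivided (edges K))"
    unfolding im[symmetric] by (rule image_Union)
  then have "bij_betw f (\<Union>sign_chains) (\<Union>(subdivided (edges K)))"
    using f_inj unfolding bij_betw_def Union by simp
  then have "complex_iso (sign_chains :: (real ^ 'n) set set) (subdivided (edges K))"
    using im unfolding complex_iso_def by blast
  then show ?thesis
    using tchebyshev_triangulation_subdivided unfolding K_def by blast
qed

lemma complex_iso_sym: "complex_iso K L \<Longrightarrow> complex_iso L K"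
  unfolding complex_iso_def
proof (elim exE conjE)
  fix f assume f: "bij_betw f (\<Union>K) (\<Union>L)" "(\<lambda>\<sigma>. f ` \<sigma>) ` K = L"
  let ?h = "inv_into (\<Union>K) f"
  have "?h ` f ` \<sigma> = \<sigma>" if "\<sigma> \<in> K" for \<sigma>
    using inv_into_image_cancel[OF bij_betw_imp_inj_on[OF f(1)]] that by blast
  then have "(\<lambda>\<sigma>. ?h ` \<sigma>) ` L = K"
    unfolding f(2)[symmetric] image_image by simp
  then show "\<exists>h. bij_betw h (\<Union>L) (\<Union>K) \<and> (\<lambda>\<sigma>. h ` \<sigma>) ` L = K"
    using bij_betw_inv_into[OF f(1)] by blast
qed

lemma complex_iso_trans:
  assumes "complex_iso K L" "complex_iso L M"
  shows "complex_iso K M"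
proof -
  obtain f g where f: "bij_betw f (\<Union>K) (\<Union>L)" "(\<lambda>\<sigma>. f ` \<sigma>) ` K = L"
    and g: "bij_betw g (\<Union>L) (\<Union>M)" "(\<lambda>\<sigma>. g ` \<sigma>) ` L = M"
    using assms unfolding complex_iso_def by blast
  have "bij_betw (g \<circ> f) (\<Union>K) (\<Union>M)" using f(1) g(1) by (rule bij_betw_trans)
  moreover have "(\<lambda>\<sigma>. (g \<circ> f) ` \<sigma>) ` K = M"
    unfolding g(2)[symmetric] f(2)[symmetric] image_image by (simp add: image_comp)
  ultimately show ?thesis unfolding complex_iso_def by blast
qed

text \<open>The first conjunct gives the second one content. The second speaks of duals in any
  Euclidean space, since a dual is determined by its face lattice only up to combinatorial
  equivalence.\<close>

theorem corollary3p3: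
  shows "(\<exists>Q :: (real ^ 'n) set. dual_polytope (perm_B :: (real ^ 'n) set) Q) \<and>
    (\<forall>Q :: 'b::euclidean_space set. dual_polytope (perm_B :: (real ^ 'n) set) Q \<longrightarrow>
       simplicial_polytope Q \<and>
       (\<exists>T. tchebyshev_triangulation
              (suspension (order_complex (Pow {1..CARD('n)} - {{}, {1..CARD('n)}}))) T \<and>
            complex_iso (boundary_complex Q) T))"
proof (intro conjI allI impI)
  show "\<exists>Q :: (real ^ 'n) set. dual_polytope (perm_B :: (real ^ 'n) set) Q"
    by (rule ex_dual_perm_B)
  fix Q :: "'b set" assume Q: "dual_polytope (perm_B :: (real ^ 'n) set) Q"
  note iso = dual_perm_B_boundary_complex[OF Q]
  then show "simplicial_polytope Q" by (rule conjunct1)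
  obtain p :: "'n \<Rightarrow> nat" where "bij_betw p UNIV {1..CARD('n)}"
    using bij_betw_inv_into ex_bij_betw_nat_finite_1[of "UNIV :: 'n set"] by auto
  then obtain T where T: "tchebyshev_triangulation
      (suspension (order_complex (Pow {1..CARD('n)} - {{}, {1..CARD('n)}}))) T"
      "complex_iso (sign_chains :: (real ^ 'n) set set) T"
    using complex_iso_sign_chains_tchebyshev[of "{1..CARD('n)}" p] by auto
  have "complex_iso (boundary_complex Q) T"
    by (rule complex_iso_trans[OF complex_iso_sym[OF conjunct2[OF iso]] T(2)])
  with T(1) show "\<exists>T. tchebyshev_triangulation
      (suspension (order_complex (Pow {1..CARD('n)} - {{}, {1..CARD('n)}}))) T \<and>
      complex_iso (boundary_complex Q) T"
    by blast
qed

end
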